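(* Consider problem (P') and Algorithm 4 described in the context. Let $\{(x_1^k,\dots,x_N^k,\lambda^k)\}_{k\ge 0}$ be a sequence generated by Algorithm 4, and suppose the parameters satisfy $$\beta>\frac{6+18\sqrt3}{13}L,\qquad \gamma\in\left(\frac{12}{13\beta+\sqrt{13\beta^2-12\beta L-72L^2}},\ \frac{12}{13\beta-\sqrt{13\beta^2-12\beta L-72L^2}}\right),\qquad \sigma>\max\left\{\frac6\beta L^2L_1^2,\ \frac{2\alpha}{s}\right\}.$$ Let $A_{\max}=\max_{1\le j\le N}\|A_j\|_2$ and define $$\tau:=\min\left\{-\left[\tfrac{\beta+L}{2}-\tfrac1\gamma+\tfrac6\beta\left(\beta-\tfrac1\gamma\right)^2+\tfrac{3L^2}{\beta}\right],\ \tfrac\sigma2-\tfrac3\beta L^2L_1^2\right\},$$ $$\kappa_1:=\frac{3}{\beta^2}\left[\left(\beta-\tfrac1\gamma\right)^2+L^2\max\{L_1^2,1\}\right],\qquad \kappa_2:=\left(\left|\beta-\tfrac1\gamma\right|+L\right)^2.$$ Then there is a constant $C>0$ that (apart from the problem data and algorithm parameters) depends only on the first iterate and the initial point, such that, with $$\kappa_3:=\left((L+\sqrt N\beta A_{\max}^2)\max\{L_1,1\}+\frac{\sigma+2L_2C+(L+\beta A_{\max}^2)L_1^2}{2\alpha}+\beta A_{\max}\sqrt{\kappa_1}\right)^2,$$ the following holds for every $\epsilon>0$: letting $$K:=\left\lceil\frac{3\max\{\kappa_1,\kappa_2,\kappa_3\}}{\tau\epsilon^2}\left(\Psi_G(x_1^1,\dots,x_N^1,\lambda^1,x_N^0)-f^*\right)\right\rceil$$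 and $k^*:=\operatorname{argmin}_{2\le k\le K+1}\sum_{i=1}^N\left(\|t_i^{k+1}g_i^{k+1}\|^2+\|t_i^kg_i^k\|^2+\|t_i^{k-1}g_i^{k-1}\|^2\right)$, the point $(x_1^{k^*+1},\dots,x_N^{k^*+1})$ with multiplier $\lambda^{k^*+1}$ is an $\epsilon$-stationary solution of (P').
   Context: Problem (P'): minimize $f(x_1,\dots,x_N)$ subject to $\sum_{i=1}^N A_ix_i=b$ with $A_N=I$, $x_N\in\mathbb R^{n_N}$, and $x_i\in\mathcal M_i$ for $i=1,\dots,N-1$. Here $A_i\in\mathbb R^{m\times n_i}$, $b\in\mathbb R^m$, $n_N=m$; $f:\mathbb R^{n_1}\times\cdots\times\mathbb R^{n_N}\to\mathbb R$ is smooth (possibly nonconvex) with $L$-Lipschitz gradient, $L>0$; $\nabla_if$ is the partial gradient in block $x_i$; $\mathcal M_i$ is a compact Riemannian submanifold embedded in $\mathbb R^{n_i}$ (Euclidean metric), with tangent spaces $\mathcal T_x\mathcal M_i$. Assume $f^*=\min\{f(x):x_i\in\mathcal M_i\ (i\le N-1),\ x_N\in\mathbb R^{n_N}\}$ is finite. Augmented Lagrangian: $\mathcal L_\beta(x_1,\dots,x_N,\lambda)=f(x_1,\dots,x_N)-\langle\sum_{i=1}^N A_ix_i-b,\lambda\rangle+\frac\beta2\|\sum_{i=1}^N A_ix_i-b\|^2$. Riemannian partial gradient: $\operatorname{grad}_{x_i}\mathcal L_\beta=\operatorname{Proj}_{\mathcal T_{x_i}\mathcal M_i}\{\nabla_i\mathcal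 L_\beta\}$ (orthogonal projection). Potential: $\Psi_G(x_1,\dots,x_N,\lambda,\bar x)=\mathcal L_\beta(x_1,\dots,x_N,\lambda)+\frac3\beta\left[(\beta-\frac1\gamma)^2+L^2\right]\|\bar x-x_N\|^2$. Retractions: $R_i(\bar x_i,tg)$ is a retraction on $\mathcal M_i$ at $\bar x_i\in\mathcal M_i$ in direction $g\in\mathcal T_{\bar x_i}\mathcal M_i$; the curve $Y_i(t)=R_i(\bar x_i,tg)\in\mathcal M_i$ satisfies $Y_i(0)=\bar x_i$, $Y_i'(0)=g$. The constants $L_1,L_2>0$ are such that for all $i\le N-1$ and all such curves ($t\ge0$), $\|Y_i(t)-Y_i(0)\|\le L_1t\|Y_i'(0)\|$ and $\|Y_i(t)-Y_i(0)-tY_i'(0)\|\le L_2t^2\|Y_i'(0)\|^2$ (such constants exist for compact $\mathcal M_i$). Algorithm 4: given $x_i^0\in\mathcal M_i$ ($i\le N-1$), $x_N^0\in\mathbb R^{n_N}$, $\lambda^0\in\mathbb R^m$, $\beta,\gamma,\sigma,s>0$, $\alpha\in(0,1)$; for $k=0,1,\dots$: Step 1: for $i=1,\dots,N-1$ in order: compute $g_i^k=\operatorname{grad}_{x_i}\mathcal L_\beta(x_1^{k+1},\dots,x_{i-1}^{k+1},x_i^k,\dots,x_N^k,\lambda^k)$; start with $t_i^k=s$ and, while $\mathcal L_\beta(x_1^{k+1},\dots,x_{i-1}^{k+1},R_i(x_i^k,-t_i^kg_i^k),x_{i+1}^k,\dots,x_N^k,\lambda^k)>\mathcal L_\beta(x_1^{k+1},\dots,x_{i-1}^{k+1},x_i^k,\dots,x_N^k,\lambda^k)-\frac\sigma2(t_i^k)^2\|g_i^k\|^2$,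 replace $t_i^k$ by $\alpha t_i^k$; set $x_i^{k+1}=R_i(x_i^k,-t_i^kg_i^k)$. Step 2: $x_N^{k+1}=x_N^k-\gamma\nabla_N\mathcal L_\beta(x_1^{k+1},\dots,x_{N-1}^{k+1},x_N^k,\lambda^k)$. Step 3: $\lambda^{k+1}=\lambda^k-\beta(\sum_{i=1}^N A_ix_i^{k+1}-b)$. For the last block, set $t_N^k=\gamma$ and define $g_N^k$ by $x_N^{k+1}=x_N^k+t_N^kg_N^k$. $\epsilon$-stationary solution of (P'): $x^*$ with multiplier $\lambda^*$ such that $\|\nabla_Nf(x^* )-A_N^\top\lambda^*\|\le\epsilon$, $\|\sum_{i=1}^N A_ix_i^*-b\|\le\epsilon$, and $\|\operatorname{Proj}_{\mathcal T_{x_i^*}\mathcal M_i}(\nabla_if(x^* )-A_i^\top\lambda^* )\|\le\epsilon$ for $i=1,\dots,N-1$. *)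

theory Defs
  imports "HOL-Analysis.Analysis"
begin

text \<open>\<open>Ck_on k U f\<close> and \<open>smooth_on U f\<close> are meant for open \<open>U\<close>.\<close>

primrec Ck_on :: "nat \<Rightarrow> 'a::euclidean_space set \<Rightarrow> ('a \<Rightarrow> 'b::euclidean_space) \<Rightarrow> bool" where
  "Ck_on 0 U f \<longleftrightarrow> continuous_on U f"
| "Ck_on (Suc k) U f \<longleftrightarrow>
     (\<exists>f'. (\<forall>x\<in>U. (f has_derivative f' x) (at x)) \<and> (\<forall>v. Ck_on k U (\<lambda>x. f' x v)))"

definition smooth_on :: "'a::euclidean_space set \<Rightarrow> ('a \<Rightarrow> 'b::euclidean_space) \<Rightarrow> bool" where
  "smooth_on U f \<longleftrightarrow> (\<forall>k. Ck_on k U f)"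

text \<open>Smoothness on a set that need not be open: local extendability to a smooth map.\<close>

definition smooth_map_on :: "'a::euclidean_space set \<Rightarrow> ('a \<Rightarrow> 'b::euclidean_space) \<Rightarrow> bool" where
  "smooth_map_on S f \<longleftrightarrow>
     (\<forall>p\<in>S. \<exists>U F. open U \<and> p \<in> U \<and> smooth_on U F \<and> (\<forall>q\<in>S \<inter> U. F q = f q))"

text \<open>Local slice condition: around each of its points, some diffeomorphism between open sets
  of the ambient space straightens \<open>M\<close> to a \<open>d\<close>-dimensional linear subspace.\<close>

definition embedded_submanifold :: "nat \<Rightarrow> 'a::euclidean_space set \<Rightarrow> bool" where
  "embedded_submanifold d M \<longleftrightarrow>
     (\<forall>p\<in>M. \<exists>U (V :: 'a set) \<phi> \<psi> S.
        open U \<and> p \<in> U \<and> open V \<and> homeomorphism U V \<phi> \<psi> \<and>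
        smooth_on U \<phi> \<and> smooth_on V \<psi> \<and>
        subspace S \<and> dim S = d \<and> \<phi> ` (U \<inter> M) = V \<inter> S)"

definition tangent_space :: "'a::euclidean_space set \<Rightarrow> 'a \<Rightarrow> 'a set" where
  "tangent_space M p =
     {v. \<exists>(c :: real \<Rightarrow> 'a) \<delta>. 0 < \<delta> \<and> smooth_on {-\<delta><..<\<delta>} c \<and> c ` {-\<delta><..<\<delta>} \<subseteq> M \<and>
           c 0 = p \<and> (c has_vector_derivative v) (at 0)}"

definition manifold_retraction ::
    "'a::euclidean_space set \<Rightarrow> ('a \<Rightarrow> 'a \<Rightarrow> 'a) \<Rightarrow> bool" where
  "manifold_retraction M R \<longleftrightarrow>
     smooth_map_on {(x, v). x \<in> M \<and> v \<in> tangent_space M x} (\<lambda>(x, v). R x v) \<and>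
     (\<forall>x\<in>M. R x 0 = x \<and>
        (\<forall>v\<in>tangent_space M x. R x v \<in> M \<and>
           ((\<lambda>t. R x (t *\<^sub>R v)) has_vector_derivative v) (at 0)))"

definition gradient :: "('a::euclidean_space \<Rightarrow> real) \<Rightarrow> 'a \<Rightarrow> 'a" where
  "gradient h x = (THE D. GDERIV h x :> D)"

text \<open>The product \<open>\<real>\<^sup>n\<^sub>1 \<times> \<dots> \<times> \<real>\<^sup>n\<^sub>N\<close>, with arbitrary and possibly different block sizes, is
  \<open>real ^ 'n\<close> together with a map \<open>blk :: 'n \<Rightarrow> nat\<close> that tells which block each coordinate
  belongs to; \<open>n\<^sub>i\<close> is the number of coordinates \<open>c\<close> with \<open>blk c = i\<close>. The factor
  \<open>\<real>\<^sup>n\<^sub>i\<close> is identified with the coordinate subspace \<open>block_space blk i\<close>, and the component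
  \<open>x\<^sub>i\<close> of \<open>x\<close> with \<open>block blk i x\<close>. Likewise \<open>A :: real ^ 'n ^ 'm\<close> is the row of blocks
  \<open>[A\<^sub>1 \<dots> A\<^sub>N]\<close>, and \<open>A\<^sub>i\<close> is \<open>col_block blk A i\<close>; the zero columns added by this encoding
  change neither \<open>A\<^sub>i x\<^sub>i\<close> nor the spectral norm of \<open>A\<^sub>i\<close>.\<close>

definition block :: "('n \<Rightarrow> nat) \<Rightarrow> nat \<Rightarrow> real ^ 'n \<Rightarrow> real ^ 'n" where
  "block blk i x = (\<chi> c. if blk c = i then x $ c else 0)"

definition block_space :: "('n \<Rightarrow> nat) \<Rightarrow> nat \<Rightarrow> (real ^ 'n) set" where
  "block_space blk i = {x. \<forall>c. blk c \<noteq> i \<longrightarrow> x $ c = 0}"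

definition col_block :: "('n \<Rightarrow> nat) \<Rightarrow> real ^ 'n ^ 'm \<Rightarrow> nat \<Rightarrow> real ^ 'n ^ 'm" where
  "col_block blk A i = (\<chi> r c. if blk c = i then A $ r $ c else 0)"

definition put_block :: "('n \<Rightarrow> nat) \<Rightarrow> nat \<Rightarrow> real ^ 'n \<Rightarrow> real ^ 'n \<Rightarrow> real ^ 'n" where
  "put_block blk i y x = (\<chi> c. if blk c = i then y $ c else x $ c)"

text \<open>The mixed point \<open>(x'\<^sub>1, \<dots>, x'\<^sub>i\<^sub>-\<^sub>1, x\<^sub>i, \<dots>, x\<^sub>N)\<close>.\<close>

definition mixed :: "('n \<Rightarrow> nat) \<Rightarrow> nat \<Rightarrow> real ^ 'n \<Rightarrow> real ^ 'n \<Rightarrow> real ^ 'n" where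
  "mixed blk i x' x = (\<chi> c. if blk c < i then x' $ c else x $ c)"

definition partial_gradient ::
    "('n::finite \<Rightarrow> nat) \<Rightarrow> nat \<Rightarrow> (real ^ 'n \<Rightarrow> real) \<Rightarrow> real ^ 'n \<Rightarrow> real ^ 'n" where
  "partial_gradient blk i h x = block blk i (gradient h x)"

text \<open>The tangent space is a linear subspace, so its \<^const>\<open>closest_point\<close> map is the orthogonal
  projection onto it.\<close>

definition tangent_proj ::
    "('n::finite \<Rightarrow> nat) \<Rightarrow> (nat \<Rightarrow> (real ^ 'n) set) \<Rightarrow> nat \<Rightarrow> real ^ 'n \<Rightarrow> real ^ 'n \<Rightarrow> real ^ 'n" where
  "tangent_proj blk M i x u = closest_point (tangent_space (M i) (block blk i x)) u"

definition riemannian_partial_gradient ::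
    "('n::finite \<Rightarrow> nat) \<Rightarrow> (nat \<Rightarrow> (real ^ 'n) set) \<Rightarrow> nat \<Rightarrow> (real ^ 'n \<Rightarrow> real) \<Rightarrow>
      real ^ 'n \<Rightarrow> real ^ 'n" where
  "riemannian_partial_gradient blk M i h x = tangent_proj blk M i x (partial_gradient blk i h x)"

definition residual ::
    "('n::finite \<Rightarrow> nat) \<Rightarrow> nat \<Rightarrow> real ^ 'n ^ 'm \<Rightarrow> real ^ 'm \<Rightarrow> real ^ 'n \<Rightarrow> real ^ 'm" where
  "residual blk N A b x = (\<Sum>i=1..N. col_block blk A i *v block blk i x) - b"

definition manifold_constraint ::
    "('n \<Rightarrow> nat) \<Rightarrow> nat \<Rightarrow> (nat \<Rightarrow> (real ^ 'n) set) \<Rightarrow> (real ^ 'n) set" where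
  "manifold_constraint blk N M = {x. \<forall>i\<in>{1..<N}. block blk i x \<in> M i}"

definition aug_lagrangian ::
    "('n::finite \<Rightarrow> nat) \<Rightarrow> nat \<Rightarrow> real ^ 'n ^ 'm \<Rightarrow> real ^ 'm \<Rightarrow> (real ^ 'n \<Rightarrow> real) \<Rightarrow> real \<Rightarrow>
      real ^ 'm \<Rightarrow> real ^ 'n \<Rightarrow> real" where
  "aug_lagrangian blk N A b f \<beta> lam x =
     f x - residual blk N A b x \<bullet> lam + \<beta> / 2 * (norm (residual blk N A b x))\<^sup>2"

definition potential_G ::
    "('n::finite \<Rightarrow> nat) \<Rightarrow> nat \<Rightarrow> real ^ 'n ^ 'm \<Rightarrow> real ^ 'm \<Rightarrow> (real ^ 'n \<Rightarrow> real) \<Rightarrow> real \<Rightarrow>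
      real \<Rightarrow> real \<Rightarrow> real ^ 'n \<Rightarrow> real ^ 'm \<Rightarrow> real ^ 'n \<Rightarrow> real" where
  "potential_G blk N A b f L \<beta> \<gamma> x lam xbar =
     aug_lagrangian blk N A b f \<beta> lam x
       + 3 / \<beta> * ((\<beta> - 1 / \<gamma>)\<^sup>2 + L\<^sup>2) * (norm (xbar - block blk N x))\<^sup>2"

text \<open>The backtracking loop for block \<open>i\<close> stops at
  \<open>t k i = s * \<alpha> ^ j\<close> for the first \<open>j\<close> at which the loop condition fails.\<close>

definition algorithm4 ::
    "('n::finite \<Rightarrow> nat) \<Rightarrow> nat \<Rightarrow> real ^ 'n ^ 'm \<Rightarrow> real ^ 'm \<Rightarrow> (real ^ 'n \<Rightarrow> real) \<Rightarrow>
      (nat \<Rightarrow> (real ^ 'n) set) \<Rightarrow> (nat \<Rightarrow> real ^ 'n \<Rightarrow> real ^ 'n \<Rightarrow> real ^ 'n) \<Rightarrow>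
      real \<Rightarrow> real \<Rightarrow> real \<Rightarrow> real \<Rightarrow> real \<Rightarrow>
      (nat \<Rightarrow> real ^ 'n) \<Rightarrow> (nat \<Rightarrow> real ^ 'm) \<Rightarrow> (nat \<Rightarrow> nat \<Rightarrow> real) \<Rightarrow>
      (nat \<Rightarrow> nat \<Rightarrow> real ^ 'n) \<Rightarrow> bool" where
  "algorithm4 blk N A b f M R \<beta> \<gamma> \<sigma> s \<alpha> x lam t g \<longleftrightarrow>
     x 0 \<in> manifold_constraint blk N M \<and>
     (\<forall>k. let AL = aug_lagrangian blk N A b f \<beta> (lam k) in
        (\<forall>i\<in>{1..<N}.
           let z = mixed blk i (x (Suc k)) (x k);
               trial = (\<lambda>u. R i (block blk i (x k)) (- u *\<^sub>R g k i));
               continue_loop = (\<lambda>u. AL (put_block blk i (trial u) z)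
                                     > AL z - \<sigma> / 2 * u\<^sup>2 * (norm (g k i))\<^sup>2)
           in g k i = riemannian_partial_gradient blk M i AL z \<and>
              (\<exists>j. t k i = s * \<alpha> ^ j \<and> \<not> continue_loop (s * \<alpha> ^ j) \<and>
                   (\<forall>l<j. continue_loop (s * \<alpha> ^ l))) \<and>
              block blk i (x (Suc k)) = trial (t k i)) \<and>
        block blk N (x (Suc k)) =
          block blk N (x k) - \<gamma> *\<^sub>R partial_gradient blk N AL (mixed blk N (x (Suc k)) (x k)) \<and>
        lam (Suc k) = lam k - \<beta> *\<^sub>R residual blk N A b (x (Suc k)) \<and>
        t k N = \<gamma> \<and>
        block blk N (x (Suc k)) = block blk N (x k) + t k N *\<^sub>R g k N)"

definition eps_stationary ::
    "('n::finite \<Rightarrow> nat) \<Rightarrow> nat \<Rightarrow> real ^ 'n ^ 'm \<Rightarrow> real ^ 'm \<Rightarrow> (real ^ 'n \<Rightarrow> real) \<Rightarrow>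
      (nat \<Rightarrow> (real ^ 'n) set) \<Rightarrow> real \<Rightarrow> real ^ 'n \<Rightarrow> real ^ 'm \<Rightarrow> bool" where
  "eps_stationary blk N A b f M \<epsilon> x lam \<longleftrightarrow>
     x \<in> manifold_constraint blk N M \<and>
     norm (partial_gradient blk N f x - transpose (col_block blk A N) *v lam) \<le> \<epsilon> \<and>
     norm (residual blk N A b x) \<le> \<epsilon> \<and>
     (\<forall>i\<in>{1..<N}.
        norm (tangent_proj blk M i x
                (partial_gradient blk i f x - transpose (col_block blk A i) *v lam)) \<le> \<epsilon>)"

end

theory Submission
  imports Defs
begin

text \<open>Eliminating the gradient step for the last block, where \<open>A\<^sub>N = I\<close>, expresses
  \<open>\<lambda>\<^sup>k\<^sup>+\<^sup>1\<close> by a partial gradient of \<open>f\<close> and the last increment of \<open>x\<^sub>N\<close>. Hence the ascent of the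
  augmented Lagrangian caused by the multiplier step is controlled by block increments, and the
  potential \<open>\<Psi>\<close> decreases by at least \<open>\<tau> S k\<close>, where \<open>S k = \<Sum>\<^sub>i \<parallel>t\<^sub>i\<^sup>k g\<^sub>i\<^sup>k\<parallel>\<^sup>2\<close>, and never
  falls below \<open>f\<^sup>*\<close>. So the sum of \<open>S k\<close> over \<open>k \<ge> 1\<close> is bounded, and the best of \<open>K\<close> windows of
  three consecutive terms is small. Backtracking keeps the step sizes from being too short:
  either \<open>t\<^sub>i\<^sup>k = s\<close>, or the rejected step \<open>t\<^sub>i\<^sup>k / \<alpha>\<close> violates a Taylor estimate, so
  \<open>\<parallel>g\<^sub>i\<^sup>k\<parallel>\<close> is at most a constant times \<open>\<parallel>t\<^sub>i\<^sup>k g\<^sub>i\<^sup>k\<parallel>\<close>. The constant \<open>C\<close> in that estimate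
  bounds the gradients of the augmented Lagrangian; it exists because the manifolds are compact
  and bounded residuals then bound \<open>x\<^sub>N\<close>, although \<open>x\<^sub>N\<close> itself is unconstrained.\<close>

section \<open>Tangent spaces of embedded submanifolds\<close>

lemma Ck_on_compose_affine:
  fixes a w :: "'a::euclidean_space" and f :: "'a \<Rightarrow> 'b::euclidean_space"
  assumes "Ck_on k V f" and "\<And>s. s \<in> I \<Longrightarrow> a + s *\<^sub>R w \<in> V"
  shows "Ck_on k I (\<lambda>s::real. f (a + s *\<^sub>R w))"
  using assms(1)
proof (induction k arbitrary: f)
  case 0
  then have "continuous_on V f" by simp
  then have "continuous_on I (\<lambda>s. f (a + s *\<^sub>R w))"
    by (rule continuous_on_compose2) (use assms(2) in \<open>auto intro!: continuous_intros\<close>)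
  then show ?case by simp
next
  case (Suc k)
  then obtain f' where f': "\<And>y. y \<in> V \<Longrightarrow> (f has_derivative f' y) (at y)"
    and C: "\<And>v. Ck_on k V (\<lambda>y. f' y v)" by auto
  have "((\<lambda>s. f (a + s *\<^sub>R w)) has_derivative (\<lambda>h. f' (a + s *\<^sub>R w) (h *\<^sub>R w))) (at s)"
    if "s \<in> I" for s
  proof (rule has_derivative_compose[where g = f and f = "\<lambda>s. a + s *\<^sub>R w"])
    show "((\<lambda>s. a + s *\<^sub>R w) has_derivative (\<lambda>h. h *\<^sub>R w)) (at s)"
      by (auto intro!: derivative_eq_intros)
    show "(f has_derivative f' (a + s *\<^sub>R w)) (at (a + s *\<^sub>R w))"
      using f' assms(2) that by blast
  qed
  moreover have "Ck_on k I (\<lambda>s. f' (a + s *\<^sub>R w) (h *\<^sub>R w))" for h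
    using Suc.IH[OF C] .
  ultimately show ?case
    by (auto intro!: exI[where x = "\<lambda>s h. f' (a + s *\<^sub>R w) (h *\<^sub>R w)"])
qed

text \<open>Applied to an inverse slice chart, this gives the smooth curves that witness tangent
  vectors.\<close>

lemma smooth_on_compose_affine:
  fixes a w :: "'a::euclidean_space"
  assumes "smooth_on V f" "\<And>s. s \<in> I \<Longrightarrow> a + s *\<^sub>R w \<in> V"
  shows "smooth_on I (\<lambda>s::real. f (a + s *\<^sub>R w))"
  using assms Ck_on_compose_affine unfolding smooth_on_def by blast

lemma smooth_on_imp_has_derivative:
  assumes "smooth_on U f" "p \<in> U"
  obtains f' where "(f has_derivative f') (at p)"
proof -
  have "Ck_on (Suc 0) U f" using assms(1) unfolding smooth_on_def by blast
  then show ?thesis using assms(2) that by auto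
qed

text \<open>The difference quotients lie in \<open>S\<close>, and a subspace of a Euclidean space is
  closed, so their limit stays in \<open>S\<close>.\<close>

lemma has_vector_derivative_in_closed_subspace:
  fixes c :: "real \<Rightarrow> 'a::euclidean_space"
  assumes "subspace S" and "(c has_vector_derivative v) (at 0)"
    and "\<forall>\<^sub>F s in at 0. c s \<in> S" and "c 0 \<in> S"
  shows "v \<in> S"
proof (rule Lim_in_closed_set[where F = "at (0::real)"])
  show "closed S" using assms(1) by (rule closed_subspace)
  have "((\<lambda>h. norm (c (0 + h) - c 0 - h *\<^sub>R v) / norm h) \<longlongrightarrow> 0) (at 0)"
    using assms(2) unfolding has_vector_derivative_def has_derivative_at by blast
  then have "((\<lambda>h. norm ((1 / h) *\<^sub>R (c h - c 0) - v)) \<longlongrightarrow> 0) (at 0)"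
  proof (rule Lim_transform_eventually)
    have "norm (c (0 + h) - c 0 - h *\<^sub>R v) / norm h = norm ((1 / h) *\<^sub>R (c h - c 0) - v)"
      if "h \<noteq> 0" for h
    proof -
      have "(1 / h) *\<^sub>R (c h - c 0) - v = (1 / h) *\<^sub>R (c (0 + h) - c 0 - h *\<^sub>R v)"
        using that by (simp add: algebra_simps)
      then show ?thesis by simp
    qed
    then show "\<forall>\<^sub>F h in at 0. norm (c (0 + h) - c 0 - h *\<^sub>R v) / norm h
        = norm ((1 / h) *\<^sub>R (c h - c 0) - v)"
      by (simp add: eventually_at_filter)
  qed
  then show "((\<lambda>h. (1 / h) *\<^sub>R (c h - c 0)) \<longlongrightarrow> v) (at 0)"
    by (simp add: tendsto_norm_zero_iff LIM_zero_iff)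
  show "\<forall>\<^sub>F h in at 0. (1 / h) *\<^sub>R (c h - c 0) \<in> S"
    using assms(3) by eventually_elim (use assms(1,4) in \<open>auto intro: subspace_scale subspace_diff\<close>)
qed auto

text \<open>In a slice chart the tangent space is the image of the linear slice under the derivative
  of the inverse chart. The definition by curves does not show linearity, but reading the closest
  point as an orthogonal projection depends on it.\<close>

lemma subspace_tangent_space:
  assumes M: "embedded_submanifold d M" and p: "p \<in> M"
  shows "subspace (tangent_space M p)"
proof -
  obtain U and V :: "'a set" and \<phi> \<psi> S where U: "open U" "p \<in> U" and V: "open V" and hom: "homeomorphism U V \<phi> \<psi>"
    and smooth: "smooth_on U \<phi>" "smooth_on V \<psi>" and S: "subspace S"
    and img: "\<phi> ` (U \<inter> M) = V \<inter> S"
    using M p unfolding embedded_submanifold_def by meson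
  have \<psi>\<phi>: "\<psi> (\<phi> y) = y" if "y \<in> U" for y
    using hom that by (simp add: homeomorphism_def)
  have \<phi>p: "\<phi> p \<in> V" "\<phi> p \<in> S" using img U p by blast+
  obtain \<phi>' where \<phi>': "(\<phi> has_derivative \<phi>') (at p)"
    using smooth_on_imp_has_derivative[OF smooth(1) U(2)] .
  obtain \<psi>' where \<psi>': "(\<psi> has_derivative \<psi>') (at (\<phi> p))"
    using smooth_on_imp_has_derivative[OF smooth(2) \<phi>p(1)] .
  have "tangent_space M p = \<psi>' ` S"
  proof (intro equalityI subsetI)
    fix v assume "v \<in> tangent_space M p"
    then obtain c \<delta> where c: "0 < \<delta>" "c ` {-\<delta><..<\<delta>} \<subseteq> M" "c 0 = p"
      and dc: "(c has_vector_derivative v) (at (0::real))"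
      unfolding tangent_space_def by auto
    have lim: "(c \<longlongrightarrow> p) (at 0)"
      using has_vector_derivative_continuous[OF dc] c(3) by (simp add: continuous_at)
    have "\<forall>\<^sub>F s in at 0. c s \<in> U"
      using topological_tendstoD[OF lim U(1)] U(2) by simp
    moreover have "\<forall>\<^sub>F s in at (0::real). s \<in> {-\<delta><..<\<delta>}"
      using c(1) by (intro eventually_at_in_open') auto
    ultimately have ev: "\<forall>\<^sub>F s in at 0. c s \<in> U \<inter> M"
      by eventually_elim (use c(2) in auto)
    have d\<phi>c: "((\<lambda>s. \<phi> (c s)) has_vector_derivative \<phi>' v) (at 0)"
      using \<phi>' dc c(3) vector_derivative_diff_chain_within[of c v 0 UNIV \<phi> \<phi>']
      by (auto simp: o_def intro: has_derivative_at_withinI)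
    have "\<phi>' v \<in> S"
      by (rule has_vector_derivative_in_closed_subspace[OF S d\<phi>c])
        (use ev img c(3) \<phi>p in \<open>auto elim!: eventually_mono\<close>)
    moreover have "((\<lambda>s. \<psi> (\<phi> (c s))) has_vector_derivative \<psi>' (\<phi>' v)) (at 0)"
      using \<psi>' d\<phi>c c(3) vector_derivative_diff_chain_within[of "\<lambda>s. \<phi> (c s)" "\<phi>' v" 0 UNIV \<psi> \<psi>']
      by (auto simp: o_def intro: has_derivative_at_withinI)
    \<comment> \<open>Near 0 the curve stays in the chart domain, where \<psi> undoes \<phi>, so the
      derivative of the composition is that of \<open>c\<close> itself.\<close>
    then have "(c has_vector_derivative \<psi>' (\<phi>' v)) (at 0)"
      unfolding has_vector_derivative_def
      by (rule has_derivative_transform_eventually)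
        (use ev U(2) c(3) \<psi>\<phi> in \<open>auto elim!: eventually_mono\<close>)
    then have "v = \<psi>' (\<phi>' v)"
      using dc vector_derivative_unique_at by blast
    ultimately show "v \<in> \<psi>' ` S" by blast
  next
    fix v assume "v \<in> \<psi>' ` S"
    then obtain w where w: "w \<in> S" "v = \<psi>' w" by blast
    obtain e where e: "e > 0" "ball (\<phi> p) e \<subseteq> V"
      using V \<phi>p(1) by (meson open_contains_ball)
    \<comment> \<open>The added 1 keeps the quotient defined when \<open>w\<close> is zero.\<close>
    define \<delta> where "\<delta> = e / (norm w + 1)"
    have \<delta>: "\<delta> > 0" using e(1) by (simp add: \<delta>_def add_nonneg_pos)
    have inV: "\<phi> p + s *\<^sub>R w \<in> V" if "s \<in> {-\<delta><..<\<delta>}" for s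
    proof -
      have "\<bar>s\<bar> < \<delta>" using that by auto
      then have "\<bar>s\<bar> * (norm w + 1) < e"
        unfolding \<delta>_def by (simp add: pos_less_divide_eq add_nonneg_pos)
      then have "norm (s *\<^sub>R w) < e" by (simp add: algebra_simps)
      then show ?thesis using e(2) by (auto simp: dist_norm)
    qed
    have "\<psi> (\<phi> p + s *\<^sub>R w) \<in> M" if "s \<in> {-\<delta><..<\<delta>}" for s
    proof -
      have "\<phi> p + s *\<^sub>R w \<in> V \<inter> S"
        using inV[OF that] \<phi>p(2) w(1) S by (auto intro: subspace_add subspace_scale)
      then show ?thesis using img \<psi>\<phi> by (metis IntD1 IntD2 image_iff)
    qed
    moreover have "((\<lambda>s. \<psi> (\<phi> p + s *\<^sub>R w)) has_vector_derivative v) (at 0)"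
    proof -
      have "((\<lambda>s. \<phi> p + s *\<^sub>R w) has_vector_derivative w) (at 0)"
        by (auto intro!: derivative_eq_intros)
      then show ?thesis
        using \<psi>' w(2) vector_derivative_diff_chain_within[of "\<lambda>s. \<phi> p + s *\<^sub>R w" w 0 UNIV \<psi> \<psi>']
        by (auto simp: o_def intro: has_derivative_at_withinI)
    qed
    moreover have "smooth_on {-\<delta><..<\<delta>} (\<lambda>s. \<psi> (\<phi> p + s *\<^sub>R w))"
      using smooth(2) inV by (rule smooth_on_compose_affine)
    ultimately show "v \<in> tangent_space M p"
      unfolding tangent_space_def using \<delta> \<psi>\<phi> U(2)
      by (auto intro!: exI[where x = "\<lambda>s. \<psi> (\<phi> p + s *\<^sub>R w)"] exI[where x = \<delta>])
  qed
  then show ?thesis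
    using S has_derivative_linear[OF \<psi>'] linear_subspace_image by metis
qed

section \<open>Orthogonal projection onto a subspace\<close>

lemma closest_point_subspace_mem:
  fixes T :: "'a::euclidean_space set"
  assumes "subspace T"
  shows "closest_point T u \<in> T"
  using assms closed_subspace subspace_0 closest_point_in_set by (metis empty_iff)

text \<open>Testing the variational inequality of the projection \<open>p\<close> with 0 and with
  \<open>2 p\<close> gives both inequalities, so \<open>u - p\<close> is orthogonal to
  \<open>p\<close>.\<close>

lemma inner_closest_point_subspace:
  fixes T :: "'a::euclidean_space set"
  assumes "subspace T"
  shows "u \<bullet> closest_point T u = (norm (closest_point T u))\<^sup>2"
proof -
  let ?p = "closest_point T u"
  have T: "convex T" "closed T" using assms by (auto simp: subspace_imp_convex closed_subspace)
  have "(u - ?p) \<bullet> (0 - ?p) \<le> 0"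
    using closest_point_dot[OF T] assms subspace_0 by blast
  moreover have "(u - ?p) \<bullet> (2 *\<^sub>R ?p - ?p) \<le> 0"
    using closest_point_dot[OF T] assms closest_point_subspace_mem subspace_scale by blast
  ultimately show ?thesis
    by (simp add: inner_diff_left inner_diff_right power2_norm_eq_inner scaleR_2)
qed

lemma norm_closest_point_subspace_diff:
  fixes T :: "'a::euclidean_space set"
  assumes "subspace T"
  shows "norm (closest_point T u - closest_point T v) \<le> norm (u - v)"
  using closest_point_lipschitz[of T u v] assms subspace_0
  by (fastforce simp: dist_norm subspace_imp_convex closed_subspace)

section \<open>Gradients and the quadratic upper bound\<close>

lemma gradient_eqI:
  assumes "GDERIV h x :> D"
  shows "gradient h x = D"
  unfolding gradient_def
proof (rule the_equality)
  fix D' assume "GDERIV h x :> D'"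
  with assms have "(\<lambda>v. v \<bullet> D') = (\<lambda>v. v \<bullet> D)"
    unfolding gderiv_def by (rule has_derivative_unique[rotated])
  then have "v \<bullet> D' = v \<bullet> D" for v by metis
  then show "D' = D"
    by (metis inner_commute vector_eq_rdot)
qed (fact assms)

text \<open>The Riesz vector of the derivative, written out in the basis, shows existence. Together
  with \<open>gradient_eqI\<close> this justifies the definite description in
  \<open>gradient\<close>.\<close>

lemma GDERIV_gradient:
  fixes h :: "'a::euclidean_space \<Rightarrow> real"
  assumes "h differentiable (at x)"
  shows "GDERIV h x :> gradient h x"
proof -
  obtain h' where h': "(h has_derivative h') (at x)"
    using assms unfolding differentiable_def by blast
  interpret h': bounded_linear h' using h' by (rule has_derivative_bounded_linear)
  have "h' v = v \<bullet> (\<Sum>b\<in>Basis. h' b *\<^sub>R b)" for v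
  proof -
    have "h' v = h' (\<Sum>b\<in>Basis. (v \<bullet> b) *\<^sub>R b)" by (simp add: euclidean_representation)
    also have "\<dots> = (\<Sum>b\<in>Basis. (v \<bullet> b) * h' b)" by (simp add: h'.sum h'.scaleR)
    finally show ?thesis by (simp add: inner_sum_right mult.commute)
  qed
  then have "h' = (\<lambda>v. v \<bullet> (\<Sum>b\<in>Basis. h' b *\<^sub>R b))" by blast
  then have "GDERIV h x :> (\<Sum>b\<in>Basis. h' b *\<^sub>R b)" using h' by (simp add: gderiv_def)
  then show ?thesis using gradient_eqI by metis
qed

text \<open>Along the segment from \<open>x\<close> to \<open>x + d\<close>, the function minus its
  claimed quadratic bound has nonpositive derivative, because the gradient changes by at most
  \<open>L * s * norm d\<close> up to time \<open>s\<close>.\<close>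

lemma lipschitz_gradient_upper_bound:
  fixes h :: "'a::euclidean_space \<Rightarrow> real"
  assumes diff: "\<And>x. h differentiable (at x)" and lip: "L-lipschitz_on UNIV (gradient h)"
  shows "h (x + d) \<le> h x + gradient h x \<bullet> d + L / 2 * (norm d)\<^sup>2"
proof -
  define \<phi> where "\<phi> s = h (x + s *\<^sub>R d) - s * (gradient h x \<bullet> d) - L / 2 * s\<^sup>2 * (norm d)\<^sup>2" for s
  have "\<exists>y. (\<phi> has_real_derivative y) (at s) \<and> y \<le> 0" if "0 \<le> s" "s \<le> 1" for s
  proof (intro exI conjI)
    have "((\<lambda>s. x + s *\<^sub>R d) has_derivative (\<lambda>e. e *\<^sub>R d)) (at s)"
      by (auto intro!: derivative_eq_intros)
    moreover have "(h has_derivative (\<lambda>v. v \<bullet> gradient h (x + s *\<^sub>R d))) (at (x + s *\<^sub>R d))"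
      using GDERIV_gradient[OF diff] unfolding gderiv_def .
    ultimately have "((\<lambda>s. h (x + s *\<^sub>R d)) has_derivative
        (\<lambda>e. (e *\<^sub>R d) \<bullet> gradient h (x + s *\<^sub>R d))) (at s)"
      by (rule has_derivative_compose)
    then have *: "((\<lambda>s. h (x + s *\<^sub>R d)) has_real_derivative (gradient h (x + s *\<^sub>R d) \<bullet> d)) (at s)"
      unfolding has_field_derivative_def
      by (rule has_derivative_eq_rhs) (auto simp: fun_eq_iff inner_commute)
    show "(\<phi> has_real_derivative (gradient h (x + s *\<^sub>R d) \<bullet> d - gradient h x \<bullet> d
        - L * s * (norm d)\<^sup>2)) (at s)"
      unfolding \<phi>_def by (auto intro!: derivative_eq_intros * simp: algebra_simps)
    have "(gradient h (x + s *\<^sub>R d) - gradient h x) \<bullet> d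
        \<le> norm (gradient h (x + s *\<^sub>R d) - gradient h x) * norm d"
      by (rule norm_cauchy_schwarz)
    also have "\<dots> \<le> (L * norm (s *\<^sub>R d)) * norm d"
      using lipschitz_onD[OF lip, of "x + s *\<^sub>R d" x]
      by (intro mult_right_mono) (auto simp: dist_norm)
    finally show "gradient h (x + s *\<^sub>R d) \<bullet> d - gradient h x \<bullet> d - L * s * (norm d)\<^sup>2 \<le> 0"
      using that by (simp add: inner_diff_left power2_eq_square mult.assoc)
  qed
  then have "\<phi> 1 \<le> \<phi> 0"
    by (intro DERIV_nonpos_imp_nonincreasing[of 0 1 \<phi>]) auto
  then show ?thesis by (simp add: \<phi>_def)
qed

section \<open>Block decomposition and the augmented Lagrangian\<close>

lemma block_nth: "block blk i x $ c = (if blk c = i then x $ c else 0)"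
  by (simp add: block_def)

lemma mixed_nth: "mixed blk i x' x $ c = (if blk c < i then x' $ c else x $ c)"
  by (simp add: mixed_def)

lemma block_add: "block blk i (x + y) = block blk i x + block blk i y"
  and block_diff: "block blk i (x - y) = block blk i x - block blk i y"
  and block_scaleR: "block blk i (r *\<^sub>R x) = r *\<^sub>R block blk i x"
  and block_block: "block blk i (block blk j x) = (if i = j then block blk i x else 0)"
  by (auto simp: vec_eq_iff block_nth)

lemma block_eq_self: "v \<in> block_space blk i \<Longrightarrow> block blk i v = v"
  by (auto simp: vec_eq_iff block_nth block_space_def)

lemma block_mem_block_space: "block blk i v \<in> block_space blk i"
  by (auto simp: block_nth block_space_def)

lemma inner_block: "block blk i u \<bullet> v = u \<bullet> block blk i v"
  by (auto simp: inner_vec_def block_nth intro!: sum.cong)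

lemma norm_block_le: "norm (block blk i x) \<le> norm x"
  by (rule norm_le_componentwise_cart) (simp add: block_nth)

lemma block_mixed_same [simp]: "block blk i (mixed blk i x' x) = block blk i x"
  by (auto simp: vec_eq_iff block_nth mixed_nth)

text \<open>Turns a line-search trial into an additive displacement within one block, the form that
  \<open>AL_upper_bound\<close> accepts.\<close>

lemma put_block_eq_add:
  assumes "y \<in> block_space blk i"
  shows "put_block blk i y x = x + (y - block blk i x)"
  using assms by (auto simp: vec_eq_iff put_block_def block_nth block_space_def)

lemma mixed_Suc: "mixed blk (Suc i) x' x = mixed blk i x' x + block blk i (x' - x)"
  by (auto simp: vec_eq_iff block_nth mixed_nth less_Suc_eq)

lemma mixed_eq_diff_sum:
  "mixed blk i x' x = x + (\<Sum>j<i. block blk j (x' - x))"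
  by (induction i) (auto simp: mixed_Suc add.assoc vec_eq_iff mixed_nth)

lemma matrix_vector_mult_block: "col_block blk A i *v y = A *v block blk i y"
  by (auto simp: vec_eq_iff matrix_vector_mult_def col_block_def block_nth intro!: sum.cong)

lemma transpose_col_block_mult: "transpose (col_block blk A i) *v l = block blk i (l v* A)"
  by (auto simp: vec_eq_iff vector_matrix_mult_def col_block_def block_nth matrix_vector_mult_def
      transpose_def mult.commute simp del: transpose_matrix_vector)

lemma inner_vector_matrix_mult: "(l v* A) \<bullet> y = l \<bullet> (A *v (y :: real ^ 'n))" for A :: "real ^ 'n::finite ^ 'm::finite"
  by (rule dot_lmul_matrix)

lemma sum_abs_le_sqrt_card:
  fixes a :: "'i \<Rightarrow> real"
  assumes "finite I"
  shows "(\<Sum>i\<in>I. \<bar>a i\<bar>) \<le> sqrt (card I) * sqrt (\<Sum>i\<in>I. (a i)\<^sup>2)"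
  using L2_set_mult_ineq[of "\<lambda>_. 1" a I] by (simp add: L2_set_def)

text \<open>The right side minus the left side is the sum of the squared pairwise distances of
  \<open>a\<close>, \<open>b\<close> and \<open>c\<close>.\<close>

lemma norm_add3_power2_le:
  fixes a b c :: "'a::real_inner"
  shows "(norm (a + b + c))\<^sup>2 \<le> 3 * ((norm a)\<^sup>2 + (norm b)\<^sup>2 + (norm c)\<^sup>2)"
proof -
  have "0 \<le> (norm (a - b))\<^sup>2 + (norm (b - c))\<^sup>2 + (norm (a - c))\<^sup>2" by simp
  then show ?thesis
    by (simp add: power2_norm_eq_inner inner_add_left inner_add_right inner_diff_left
        inner_diff_right inner_commute algebra_simps)
qed

text \<open>Rows and columns of \<open>A\<close> have different index types, so
  \<open>A\<^sub>N = I\<close> is stated through a bijection \<open>last_col\<close> that matches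
  each row with a coordinate of block \<open>N\<close>.\<close>

locale block_data =
  fixes blk :: "'n::finite \<Rightarrow> nat" and N :: nat
    and A :: "real ^ 'n ^ 'm::finite" and b :: "real ^ 'm" and last_col :: "'m \<Rightarrow> 'n"
    and f :: "real ^ 'n \<Rightarrow> real" and L \<beta> :: real
  assumes blocks: "range blk = {1..N}"
    and A_N_square: "bij_betw last_col UNIV {c. blk c = N}"
    and A_N_identity: "\<And>p q. A $ p $ last_col q = (if p = q then 1 else 0)"
    and f_diff: "\<And>x. f differentiable (at x)"
    and f_grad_lipschitz: "L-lipschitz_on UNIV (gradient f)"
    and L_pos: "0 < L" and \<beta>_pos: "0 < \<beta>"
begin

definition A_max :: real where
  "A_max = Max ((\<lambda>j. onorm (\<lambda>y. col_block blk A j *v y)) ` {1..N})"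

abbreviation res :: "real ^ 'n \<Rightarrow> real ^ 'm" where
  "res \<equiv> residual blk N A b"

abbreviation AL :: "real ^ 'm \<Rightarrow> real ^ 'n \<Rightarrow> real" where
  "AL \<equiv> aug_lagrangian blk N A b f \<beta>"

text \<open>The gradient of \<open>AL l\<close> in closed form (see \<open>gradient_AL\<close>);
  \<open>y v* A\<close> is the transpose of \<open>A\<close> applied to \<open>y\<close>.\<close>

definition GAL :: "real ^ 'm \<Rightarrow> real ^ 'n \<Rightarrow> real ^ 'n" where
  "GAL l x = gradient f x - l v* A + \<beta> *\<^sub>R (res x v* A)"

lemma blk_bounds: "1 \<le> blk c" "blk c \<le> N"
  using blocks by (metis atLeastAtMost_iff rangeI)+

lemma N_ge_1: "1 \<le> N"
  using blk_bounds le_trans by blast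

lemma mixed_1 [simp]: "mixed blk 1 x' x = x" "mixed blk (Suc 0) x' x = x"
proof -
  have "blk c = 0 \<longleftrightarrow> False" for c using blk_bounds(1)[of c] by simp
  note this [simp]
  show "mixed blk 1 x' x = x" "mixed blk (Suc 0) x' x = x"
    by (simp_all add: vec_eq_iff mixed_nth)
qed

lemma mixed_Suc_N [simp]: "mixed blk (Suc N) x' x = x'"
  using blk_bounds(2) by (simp add: vec_eq_iff mixed_nth less_Suc_eq_le)

lemma mixed_N: "mixed blk N x' x = x' - block blk N (x' - x)"
  using mixed_Suc[of blk N x' x] by (simp add: algebra_simps)

lemma sum_block: "(\<Sum>i=1..N. block blk i x) = x"
  using blk_bounds by (auto simp: vec_eq_iff block_nth)

lemma norm_eq_sum_block: "(norm x)\<^sup>2 = (\<Sum>i=1..N. (norm (block blk i x))\<^sup>2)"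
proof -
  have "(norm x)\<^sup>2 = (\<Sum>i=1..N. block blk i x) \<bullet> x"
    by (simp only: sum_block power2_norm_eq_inner)
  also have "\<dots> = (\<Sum>i=1..N. (norm (block blk i x))\<^sup>2)"
    by (simp add: inner_sum_left power2_norm_eq_inner)
      (simp add: inner_block block_block)
  finally show ?thesis .
qed

lemma residual_eq: "res x = A *v x - b"
proof -
  have "(\<Sum>i=1..N. col_block blk A i *v block blk i x) = A *v (\<Sum>i=1..N. block blk i x)"
    by (simp add: matrix_vector_mult_block block_block vec.linear_sum[OF matrix_vector_mul_linear_gen])
  then show ?thesis by (simp only: residual_def sum_block)
qed

lemma residual_add: "res (x + d) = res x + A *v d"
  by (simp add: residual_eq matrix_vector_right_distrib)

lemma GDERIV_AL: "GDERIV (AL l) x :> GAL l x"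
proof -
  have f: "(f has_derivative (\<lambda>h. h \<bullet> gradient f x)) (at x)"
    using GDERIV_gradient[OF f_diff] by (simp add: gderiv_def)
  have r: "(res has_derivative (\<lambda>h. A *v h)) (at x)"
    unfolding residual_eq[abs_def]
    by (auto intro!: derivative_eq_intros bounded_linear_imp_has_derivative)
  have *: "AL l = (\<lambda>y. f y - res y \<bullet> l + \<beta> / 2 * (res y \<bullet> res y))"
    by (simp add: aug_lagrangian_def power2_norm_eq_inner fun_eq_iff)
  show ?thesis
    unfolding gderiv_def *
    by (rule derivative_eq_intros f r refl)+
      (auto simp: fun_eq_iff GAL_def inner_diff_right inner_add_right
        inner_vector_matrix_mult inner_commute[of _ "_ v* A"] inner_commute[of "A *v _"]
        field_simps)
qed

lemma gradient_AL: "gradient (AL l) x = GAL l x"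
  using GDERIV_AL by (rule gradient_eqI)

text \<open>Only \<open>f\<close> needs an estimate, since the penalty is quadratic and expands
  exactly. Keeping \<open>norm (A *v d)\<close> allows the sharp constant \<beta> in the last block
  and \<open>A_max\<close> in the others.\<close>

lemma AL_upper_bound:
  "AL l (x + d) \<le> AL l x + GAL l x \<bullet> d + L / 2 * (norm d)\<^sup>2 + \<beta> / 2 * (norm (A *v d))\<^sup>2"
proof -
  have "f (x + d) \<le> f x + gradient f x \<bullet> d + L / 2 * (norm d)\<^sup>2"
    using lipschitz_gradient_upper_bound[OF f_diff f_grad_lipschitz] .
  moreover have "(norm (res x + A *v d))\<^sup>2
      = (norm (res x))\<^sup>2 + 2 * (res x \<bullet> (A *v d)) + (norm (A *v d))\<^sup>2"
    by (simp add: power2_norm_eq_inner inner_add_left inner_add_right inner_commute)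
  ultimately show ?thesis
    unfolding aug_lagrangian_def residual_add GAL_def
    by (simp add: inner_add_left inner_add_right inner_diff_left inner_vector_matrix_mult inner_commute[of _ l]
        ring_distribs)
qed

lemma gradient_f_diff_le: "norm (gradient f x - gradient f y) \<le> L * norm (x - y)"
  using lipschitz_onD[OF f_grad_lipschitz, of x y] by (simp add: dist_norm)

lemma norm_mult_block_le:
  assumes "i \<in> {1..N}"
  shows "norm (A *v block blk i x) \<le> A_max * norm (block blk i x)"
proof -
  have "norm (col_block blk A i *v block blk i x)
      \<le> onorm (\<lambda>y. col_block blk A i *v y) * norm (block blk i x)"
    by (rule onorm) simp
  also have "\<dots> \<le> A_max * norm (block blk i x)"
    unfolding A_max_def using assms by (intro mult_right_mono Max_ge) auto
  finally show ?thesis by (simp add: matrix_vector_mult_block block_block)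
qed

lemma A_max_nonneg: "0 \<le> A_max"
proof -
  have "0 \<le> onorm (\<lambda>y. col_block blk A N *v y)" by (rule onorm_pos_le) simp
  also have "\<dots> \<le> A_max"
    unfolding A_max_def using N_ge_1 by (intro Max_ge) auto
  finally show ?thesis .
qed

text \<open>A matrix and its transpose have the same norm: pair the vector with itself, move
  \<open>A\<close> across, and cancel one factor.\<close>

lemma norm_block_vector_matrix_le:
  assumes "i \<in> {1..N}"
  shows "norm (block blk i (l v* A)) \<le> A_max * norm l"
proof -
  let ?w = "block blk i (l v* A)"
  have "(norm ?w)\<^sup>2 = l \<bullet> (A *v ?w)"
    by (simp add: power2_norm_eq_inner inner_vector_matrix_mult[symmetric] inner_block block_block)
  also have "\<dots> \<le> norm l * norm (A *v ?w)" by (rule norm_cauchy_schwarz)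
  also have "\<dots> \<le> norm l * (A_max * norm ?w)"
    using norm_mult_block_le[OF assms] by (intro mult_left_mono) auto
  finally have "norm ?w * norm ?w \<le> (A_max * norm l) * norm ?w"
    by (simp add: power2_eq_square mult_ac)
  then show ?thesis
    using A_max_nonneg by (cases "norm ?w = 0") (auto simp: mult_le_cancel_right)
qed

lemma mult_block_N_nth: "(A *v block blk N x) $ p = x $ last_col p"
proof -
  have "(A *v block blk N x) $ p = (\<Sum>c\<in>{c. blk c = N}. A $ p $ c * x $ c)"
    by (auto simp: matrix_vector_mult_def block_nth sum.If_cases if_distrib cong: if_cong intro!: sum.mono_neutral_cong_right)
  also have "\<dots> = (\<Sum>q\<in>UNIV. A $ p $ last_col q * x $ last_col q)"
    by (rule sum.reindex_bij_betw[OF A_N_square, symmetric])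
  also have "\<dots> = x $ last_col p"
    by (simp add: A_N_identity if_distrib[where f = "\<lambda>u. u * _"] cong: if_cong)
  finally show ?thesis .
qed

lemma vector_matrix_last_col: "(l v* A) $ last_col q = l $ q"
  by (simp add: vector_matrix_mult_def A_N_identity if_distrib[where f = "\<lambda>u. _ * u"]  if_distrib[where f = "\<lambda>u. u * _"] cong: if_cong)

lemma mult_block_N_vector_matrix: "A *v block blk N (l v* A) = l"
  by (simp add: vec_eq_iff mult_block_N_nth vector_matrix_last_col)

lemma vector_matrix_mult_block_N: "block blk N ((A *v block blk N x) v* A) = block blk N x"
proof -
  have "((A *v block blk N x) v* A) $ c = x $ c" if "blk c = N" for c
  proof -
    have "c \<in> range last_col"
      using that bij_betw_imp_surj_on[OF A_N_square] by simp
    then obtain q where "c = last_col q" by (rule rangeE)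
    then show ?thesis by (simp add: vector_matrix_last_col mult_block_N_nth)
  qed
  then show ?thesis by (auto simp: vec_eq_iff block_nth)
qed

text \<open>On block \<open>N\<close> the matrix acts as an isometry whose transpose is its inverse.
  This is how bounds pass between the last block, the residual and the multiplier.\<close>

lemma norm_mult_block_N: "norm (A *v block blk N x) = norm (block blk N x)"
proof -
  have "(norm (A *v block blk N x))\<^sup>2 = ((A *v block blk N x) v* A) \<bullet> block blk N x"
    by (simp add: power2_norm_eq_inner inner_vector_matrix_mult)
  also have "\<dots> = block blk N ((A *v block blk N x) v* A) \<bullet> block blk N x"
    by (simp add: inner_block block_block)
  also have "\<dots> = (norm (block blk N x))\<^sup>2"
    by (simp only: vector_matrix_mult_block_N power2_norm_eq_inner)
  finally show ?thesis by simp
qed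

lemma norm_block_N_vector_matrix: "norm (block blk N (l v* A)) = norm l"
  using norm_mult_block_N[of "l v* A"] by (simp only: mult_block_N_vector_matrix)

end

section \<open>One sweep of the algorithm and the descent of the potential\<close>

lemma vector_matrix_mult_diff_left: "(u - v) v* A = u v* A - v v* A"
  and vector_matrix_mult_scaleR_left: "(r *\<^sub>R u) v* A = r *\<^sub>R (u v* A)"
  for A :: "real ^ 'n ^ 'm"
  by (simp_all add: vec_eq_iff vector_matrix_mult_def sum_subtractf left_diff_distrib
      right_diff_distrib sum_distrib_left mult_ac)

locale algorithm4_run = block_data blk N A b last_col f L \<beta>
  for blk :: "'n::finite \<Rightarrow> nat" and N :: nat
    and A :: "real ^ 'n ^ 'm::finite" and b :: "real ^ 'm" and last_col :: "'m \<Rightarrow> 'n"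
    and f :: "real ^ 'n \<Rightarrow> real" and L \<beta> :: real +
  fixes M :: "nat \<Rightarrow> (real ^ 'n) set" and R :: "nat \<Rightarrow> real ^ 'n \<Rightarrow> real ^ 'n \<Rightarrow> real ^ 'n"
    and fstar L1 L2 \<gamma> \<sigma> s \<alpha> :: real
    and x :: "nat \<Rightarrow> real ^ 'n" and lam :: "nat \<Rightarrow> real ^ 'm"
    and t :: "nat \<Rightarrow> nat \<Rightarrow> real" and g :: "nat \<Rightarrow> nat \<Rightarrow> real ^ 'n"
  assumes M_ambient: "\<And>i. i \<in> {1..<N} \<Longrightarrow> M i \<subseteq> block_space blk i"
    and M_submanifold: "\<And>i. i \<in> {1..<N} \<Longrightarrow> \<exists>d. embedded_submanifold d (M i)"
    and f_ge: "\<And>y. y \<in> manifold_constraint blk N M \<Longrightarrow> fstar \<le> f y"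
    and R_retraction: "\<And>i. i \<in> {1..<N} \<Longrightarrow> manifold_retraction (M i) (R i)"
    and L1_pos: "0 < L1" and L2_pos: "0 < L2"
    and R_L1: "\<And>i y v u. i \<in> {1..<N} \<Longrightarrow> y \<in> M i \<Longrightarrow> v \<in> tangent_space (M i) y \<Longrightarrow> 0 \<le> u \<Longrightarrow>
                 norm (R i y (u *\<^sub>R v) - y) \<le> L1 * u * norm v"
    and R_L2: "\<And>i y v u. i \<in> {1..<N} \<Longrightarrow> y \<in> M i \<Longrightarrow> v \<in> tangent_space (M i) y \<Longrightarrow> 0 \<le> u \<Longrightarrow>
                 norm (R i y (u *\<^sub>R v) - y - u *\<^sub>R v) \<le> L2 * u\<^sup>2 * (norm v)\<^sup>2"
    and \<gamma>_pos: "0 < \<gamma>" and \<sigma>_pos: "0 < \<sigma>" and s_pos: "0 < s" and \<alpha>_pos: "0 < \<alpha>"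
    and alg: "algorithm4 blk N A b f M R \<beta> \<gamma> \<sigma> s \<alpha> x lam t g"
begin

abbreviation z :: "nat \<Rightarrow> nat \<Rightarrow> real ^ 'n" where
  "z k i \<equiv> mixed blk i (x (Suc k)) (x k)"

definition T :: "nat \<Rightarrow> nat \<Rightarrow> real" where
  "T k i = (norm (t k i *\<^sub>R g k i))\<^sup>2"

definition S :: "nat \<Rightarrow> real" where
  "S k = (\<Sum>i=1..N. T k i)"

abbreviation dN :: "nat \<Rightarrow> real ^ 'n" where
  "dN k \<equiv> block blk N (x (Suc k)) - block blk N (x k)"

text \<open>The index is shifted by one: \<open>\<Psi> 0\<close> is the potential at the first
  iterate, the value that enters \<open>K\<close>.\<close>

abbreviation \<Psi> :: "nat \<Rightarrow> real" where
  "\<Psi> k \<equiv> potential_G blk N A b f L \<beta> \<gamma> (x (Suc k)) (lam (Suc k)) (block blk N (x k))"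

definition \<tau> :: real where
  "\<tau> = min (- ((\<beta> + L) / 2 - 1 / \<gamma> + 6 / \<beta> * (\<beta> - 1 / \<gamma>)\<^sup>2 + 3 * L\<^sup>2 / \<beta>))
             (\<sigma> / 2 - 3 / \<beta> * L\<^sup>2 * L1\<^sup>2)"

lemma T_nonneg: "0 \<le> T k i"
  by (simp add: T_def)

lemma S_nonneg: "0 \<le> S k"
  by (simp add: S_def T_nonneg sum_nonneg)

lemma S_eq: "S k = (\<Sum>i\<in>{1..<N}. T k i) + T k N"
  unfolding S_def using N_ge_1 by (simp add: atLeastLessThanSuc_atLeastAtMost[symmetric])

lemma T_le_S: "i \<in> {1..N} \<Longrightarrow> T k i \<le> S k"
  unfolding S_def by (rule member_le_sum) (auto simp: T_nonneg)

lemma block_step: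
  assumes "i \<in> {1..<N}"
  shows "g k i = tangent_proj blk M i (z k i) (block blk i (GAL (lam k) (z k i)))"
    and "block blk i (x (Suc k)) = R i (block blk i (x k)) (- t k i *\<^sub>R g k i)"
    and "\<exists>j. t k i = s * \<alpha> ^ j \<and>
      AL (lam k) (put_block blk i (R i (block blk i (x k)) (- (s * \<alpha> ^ j) *\<^sub>R g k i)) (z k i))
        \<le> AL (lam k) (z k i) - \<sigma> / 2 * (s * \<alpha> ^ j)\<^sup>2 * (norm (g k i))\<^sup>2 \<and>
      (\<forall>l<j. AL (lam k) (put_block blk i (R i (block blk i (x k)) (- (s * \<alpha> ^ l) *\<^sub>R g k i)) (z k i))
        > AL (lam k) (z k i) - \<sigma> / 2 * (s * \<alpha> ^ l)\<^sup>2 * (norm (g k i))\<^sup>2)"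
  using alg assms unfolding algorithm4_def Let_def riemannian_partial_gradient_def
    partial_gradient_def gradient_AL not_less by blast+

lemma last_step:
  shows "dN k = - (\<gamma> *\<^sub>R block blk N (GAL (lam k) (z k N)))"
    and "lam (Suc k) = lam k - \<beta> *\<^sub>R res (x (Suc k))"
    and "t k N *\<^sub>R g k N = dN k"
proof -
  have *: "block blk N (x (Suc k)) = block blk N (x k) - \<gamma> *\<^sub>R block blk N (GAL (lam k) (z k N))"
      "lam (Suc k) = lam k - \<beta> *\<^sub>R res (x (Suc k))"
      "block blk N (x (Suc k)) = block blk N (x k) + t k N *\<^sub>R g k N"
    using alg unfolding algorithm4_def Let_def partial_gradient_def gradient_AL by blast+
  show "dN k = - (\<gamma> *\<^sub>R block blk N (GAL (lam k) (z k N)))" using *(1) by simp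
  show "lam (Suc k) = lam k - \<beta> *\<^sub>R res (x (Suc k))" by (fact *(2))
  show "t k N *\<^sub>R g k N = dN k" using *(3) by simp
qed

lemma tangent_proj_z: "tangent_proj blk M i (z k i) = closest_point (tangent_space (M i) (block blk i (x k)))"
  by (simp add: tangent_proj_def fun_eq_iff)

lemma subspace_tangent_space_M:
  assumes "i \<in> {1..<N}" "y \<in> M i"
  shows "subspace (tangent_space (M i) y)"
  using M_submanifold[OF assms(1)] subspace_tangent_space assms(2) by blast

text \<open>A retraction stays on the manifold only for tangent directions. That the step is tangent
  uses membership of the previous iterate, hence the induction.\<close>

lemma block_mem_M:
  assumes "i \<in> {1..<N}"
  shows "block blk i (x k) \<in> M i"
proof (induction k)
  case 0
  then show ?case
    using alg assms by (auto simp: algorithm4_def manifold_constraint_def)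
next
  case (Suc k)
  let ?T = "tangent_space (M i) (block blk i (x k))"
  have T: "subspace ?T" using subspace_tangent_space_M[OF assms Suc] .
  then have "g k i \<in> ?T"
    unfolding block_step(1)[OF assms] tangent_proj_z by (rule closest_point_subspace_mem)
  then have "- t k i *\<^sub>R g k i \<in> ?T" using T subspace_scale by blast
  then show ?case
    using R_retraction[OF assms] Suc unfolding block_step(2)[OF assms] manifold_retraction_def
    by blast
qed

lemma x_mem_manifold_constraint: "x k \<in> manifold_constraint blk N M"
  using block_mem_M by (simp add: manifold_constraint_def)

lemma subspace_tangent: "i \<in> {1..<N} \<Longrightarrow> subspace (tangent_space (M i) (block blk i (x k)))"
  using subspace_tangent_space_M block_mem_M by blast

lemma uminus_g_tangent:
  assumes "i \<in> {1..<N}"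
  shows "- g k i \<in> tangent_space (M i) (block blk i (x k))"
  unfolding block_step(1)[OF assms] tangent_proj_z
  using subspace_tangent[OF assms] closest_point_subspace_mem subspace_neg by blast

lemma t_pos: "i \<in> {1..<N} \<Longrightarrow> 0 < t k i"
  using block_step(3) s_pos \<alpha>_pos by fastforce

lemma norm_retraction_diff_le:
  assumes "i \<in> {1..<N}" "0 \<le> u"
  shows "norm (R i (block blk i (x k)) (- u *\<^sub>R g k i) - block blk i (x k)) \<le> L1 * u * norm (g k i)"
    and "norm (R i (block blk i (x k)) (- u *\<^sub>R g k i) - block blk i (x k) + u *\<^sub>R g k i)
      \<le> L2 * u\<^sup>2 * (norm (g k i))\<^sup>2"
  using R_L1[OF assms(1) block_mem_M[OF assms(1)] uminus_g_tangent[OF assms(1)] assms(2), of k]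
    R_L2[OF assms(1) block_mem_M[OF assms(1)] uminus_g_tangent[OF assms(1)] assms(2), of k]
  by simp_all

lemma norm_block_diff_le:
  assumes "i \<in> {1..<N}"
  shows "(norm (block blk i (x (Suc k) - x k)))\<^sup>2 \<le> L1\<^sup>2 * T k i"
proof -
  have "norm (block blk i (x (Suc k) - x k)) \<le> L1 * norm (t k i *\<^sub>R g k i)"
    using norm_retraction_diff_le(1)[OF assms, of "t k i" k] t_pos[OF assms, of k]
    by (simp add: block_diff block_step(2)[OF assms])
  then have "(norm (block blk i (x (Suc k) - x k)))\<^sup>2 \<le> (L1 * norm (t k i *\<^sub>R g k i))\<^sup>2"
    by (rule power_mono) simp
  then show ?thesis by (simp only: T_def power_mult_distrib)
qed

lemma T_N: "T k N = (norm (dN k))\<^sup>2"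
  by (simp add: T_def last_step(3))

lemma AL_block_step:
  assumes "i \<in> {1..<N}"
  shows "AL (lam k) (z k (Suc i)) \<le> AL (lam k) (z k i) - \<sigma> / 2 * T k i"
proof -
  have "put_block blk i (block blk i (x (Suc k))) (z k i) = z k (Suc i)"
    by (simp add: put_block_eq_add block_mem_block_space mixed_Suc block_diff)
  moreover have "AL (lam k) (put_block blk i (block blk i (x (Suc k))) (z k i))
      \<le> AL (lam k) (z k i) - \<sigma> / 2 * (t k i)\<^sup>2 * (norm (g k i))\<^sup>2"
    using block_step(3)[OF assms, of k] block_step(2)[OF assms, of k] by metis
  ultimately show ?thesis by (simp add: T_def power_mult_distrib)
qed

lemma AL_manifold_blocks:
  "AL (lam k) (z k N) \<le> AL (lam k) (x k) - \<sigma> / 2 * (\<Sum>i\<in>{1..<N}. T k i)"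
proof -
  have "AL (lam k) (z k n) \<le> AL (lam k) (x k) - \<sigma> / 2 * (\<Sum>i\<in>{1..<n}. T k i)"
    if "1 \<le> n" "n \<le> N" for n
    using that
  proof (induction n rule: dec_induct)
    case base
    then show ?case by simp
  next
    case (step n)
    then have "AL (lam k) (z k (Suc n)) \<le> AL (lam k) (z k n) - \<sigma> / 2 * T k n"
      by (intro AL_block_step) auto
    then show ?case using step by (simp add: algebra_simps)
  qed
  then show ?thesis using N_ge_1 by blast
qed

lemma z_N: "z k N = x (Suc k) - dN k"
  by (simp add: mixed_N block_diff)

lemma block_N_dN: "block blk N (dN k) = dN k"
  by (simp add: block_diff block_block)

lemma block_GAL_z_N: "block blk N (GAL (lam k) (z k N)) = - (1 / \<gamma>) *\<^sub>R dN k"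
  unfolding last_step(1) using \<gamma>_pos by simp

text \<open>Since block \<open>N\<close> of \<open>A\<close> is an isometry, the penalty has
  curvature exactly \<beta> there, and the step formula turns the linear term into
  \<open>- 1 / \<gamma>\<close> times the squared increment.\<close>

lemma AL_last_block:
  "AL (lam k) (x (Suc k)) \<le> AL (lam k) (z k N) + ((\<beta> + L) / 2 - 1 / \<gamma>) * T k N"
proof -
  have "AL (lam k) (z k N + dN k) \<le> AL (lam k) (z k N) + GAL (lam k) (z k N) \<bullet> dN k
      + L / 2 * (norm (dN k))\<^sup>2 + \<beta> / 2 * (norm (A *v dN k))\<^sup>2"
    by (rule AL_upper_bound)
  moreover have "norm (A *v dN k) = norm (dN k)"
    by (metis block_N_dN norm_mult_block_N)
  moreover have "GAL (lam k) (z k N) \<bullet> dN k = - (1 / \<gamma>) * (norm (dN k))\<^sup>2"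
  proof -
    have "GAL (lam k) (z k N) \<bullet> dN k = block blk N (GAL (lam k) (z k N)) \<bullet> dN k"
      by (metis block_N_dN inner_block)
    also have "block blk N (GAL (lam k) (z k N)) = - (1 / \<gamma>) *\<^sub>R dN k"
      by (rule block_GAL_z_N)
    finally show ?thesis by (simp add: power2_norm_eq_inner)
  qed
  ultimately show ?thesis
    by (simp add: z_N T_N algebra_simps add_divide_distrib)
qed

text \<open>The augmented Lagrangian is affine in the multiplier, with slope minus the residual, and
  the update makes the residual \<open>- 1 / \<beta>\<close> times the multiplier increment.\<close>

lemma AL_multiplier_step:
  "AL (lam (Suc k)) (x (Suc k)) = AL (lam k) (x (Suc k)) + 1 / \<beta> * (norm (lam (Suc k) - lam k))\<^sup>2"
  using \<beta>_pos
  by (simp add: aug_lagrangian_def last_step(2) inner_diff_right power_mult_distrib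
      dot_square_norm) (simp add: power2_eq_square)

text \<open>The last-block step says that block \<open>N\<close> of the gradient at
  \<open>z k N\<close> is \<open>- 1 / \<gamma>\<close> times \<open>dN k\<close>. Replacing the
  residual there by the one at the new iterate costs \<open>A *v dN k\<close>, which the transpose
  maps back to \<open>dN k\<close>; what is left contains the new multiplier.\<close>

lemma multiplier_eq:
  "block blk N (lam (Suc k) v* A) = block blk N (gradient f (z k N)) - (\<beta> - 1 / \<gamma>) *\<^sub>R dN k"
proof -
  have "res (z k N) = res (x (Suc k)) - A *v dN k"
    by (simp add: z_N residual_eq matrix_vector_mult_diff_distrib)
  then have "block blk N (GAL (lam k) (z k N)) = block blk N (gradient f (z k N))
      - block blk N (lam (Suc k) v* A) - \<beta> *\<^sub>R block blk N ((A *v dN k) v* A)"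
    unfolding GAL_def last_step(2)
    by (simp only: block_diff block_add block_scaleR vector_matrix_mult_diff_left
        vector_matrix_mult_scaleR_left scaleR_diff_right) simp
  also have "block blk N ((A *v dN k) v* A) = dN k"
    by (metis block_N_dN vector_matrix_mult_block_N)
  finally have "block blk N (lam (Suc k) v* A) = block blk N (gradient f (z k N))
      - \<beta> *\<^sub>R dN k - block blk N (GAL (lam k) (z k N))"
    by simp
  then show ?thesis
    unfolding block_GAL_z_N by (simp only: scaleR_left_diff_distrib) simp
qed

text \<open>Subtract two consecutive instances of \<open>multiplier_eq\<close> and bound the three
  resulting terms separately.\<close>

lemma multiplier_diff_le:
  "(norm (lam (Suc (Suc k)) - lam (Suc k)))\<^sup>2
    \<le> 3 * (\<beta> - 1 / \<gamma>)\<^sup>2 * T (Suc k) N + 3 * ((\<beta> - 1 / \<gamma>)\<^sup>2 + L\<^sup>2) * T k N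
      + 3 * L\<^sup>2 * L1\<^sup>2 * (\<Sum>i\<in>{1..<N}. T (Suc k) i)"
proof -
  let ?G = "\<lambda>k. block blk N (gradient f (z k N))"
  let ?c = "\<beta> - 1 / \<gamma>"
  have "block blk N ((lam (Suc (Suc k)) - lam (Suc k)) v* A)
      = (?G (Suc k) - ?G k) + (- ?c) *\<^sub>R dN (Suc k) + ?c *\<^sub>R dN k"
    unfolding vector_matrix_mult_diff_left block_diff[of _ _ "_ v* A"] multiplier_eq
    by (simp only: scaleR_minus_left) simp
  then have "(norm (lam (Suc (Suc k)) - lam (Suc k)))\<^sup>2
      = (norm ((?G (Suc k) - ?G k) + (- ?c) *\<^sub>R dN (Suc k) + ?c *\<^sub>R dN k))\<^sup>2"
    by (metis norm_block_N_vector_matrix)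
  also have "\<dots> \<le> 3 * ((norm (?G (Suc k) - ?G k))\<^sup>2 + (norm ((- ?c) *\<^sub>R dN (Suc k)))\<^sup>2
      + (norm (?c *\<^sub>R dN k))\<^sup>2)"
    by (rule norm_add3_power2_le)
  also have "(norm ((- ?c) *\<^sub>R dN (Suc k)))\<^sup>2 = ?c\<^sup>2 * T (Suc k) N"
    by (simp only: T_N norm_scaleR power_mult_distrib power2_abs power2_minus)
  also have "(norm (?c *\<^sub>R dN k))\<^sup>2 = ?c\<^sup>2 * T k N"
    by (simp only: T_N norm_scaleR power_mult_distrib power2_abs)
  also have "(norm (?G (Suc k) - ?G k))\<^sup>2
      \<le> L\<^sup>2 * (L1\<^sup>2 * (\<Sum>i\<in>{1..<N}. T (Suc k) i) + T k N)"
  proof -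
    let ?w = "z (Suc k) N - z k N"
    have "norm (?G (Suc k) - ?G k) \<le> L * norm ?w"
      unfolding block_diff[symmetric]
      using norm_block_le gradient_f_diff_le by (rule order_trans)
    then have "(norm (?G (Suc k) - ?G k))\<^sup>2 \<le> (L * norm ?w)\<^sup>2"
      by (rule power_mono) simp
    also have "\<dots> = L\<^sup>2 * (norm ?w)\<^sup>2" by (simp add: power_mult_distrib)
    also have "(norm ?w)\<^sup>2 = (\<Sum>i\<in>{1..<N}. (norm (block blk i ?w))\<^sup>2) + (norm (block blk N ?w))\<^sup>2"
      unfolding norm_eq_sum_block[of ?w] using N_ge_1
      by (simp add: atLeastLessThanSuc_atLeastAtMost[symmetric])
    \<comment> \<open>\<open>z k N\<close> still carries the old last block, so this difference is
      the increment of the preceding sweep, while the manifold blocks contribute those of the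
      current one.\<close>
    also have "block blk N ?w = dN k"
      by (simp add: block_diff)
    also have "(\<Sum>i\<in>{1..<N}. (norm (block blk i ?w))\<^sup>2)
        = (\<Sum>i\<in>{1..<N}. (norm (block blk i (x (Suc (Suc k)) - x (Suc k))))\<^sup>2)"
    proof (intro sum.cong refl)
      fix i assume "i \<in> {1..<N}"
      then have "i \<noteq> N" by simp
      then have "block blk i ?w = block blk i (x (Suc (Suc k)) - x (Suc k))"
        unfolding z_N by (simp only: block_diff block_block if_False diff_0_right diff_self)
      then show "(norm (block blk i ?w))\<^sup>2 = (norm (block blk i (x (Suc (Suc k)) - x (Suc k))))\<^sup>2"
        by simp
    qed
    finally have "(norm (?G (Suc k) - ?G k))\<^sup>2 \<le> L\<^sup>2 * ((\<Sum>i\<in>{1..<N}.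
        (norm (block blk i (x (Suc (Suc k)) - x (Suc k))))\<^sup>2) + T k N)"
      by (simp add: T_N)
    also have "\<dots> \<le> L\<^sup>2 * ((\<Sum>i\<in>{1..<N}. L1\<^sup>2 * T (Suc k) i) + T k N)"
      by (intro mult_left_mono add_mono sum_mono norm_block_diff_le) auto
    finally show ?thesis by (simp add: sum_distrib_left)
  qed
  finally show ?thesis by (simp add: algebra_simps)
qed

text \<open>The multiplier ascent contains a term in \<open>T k N\<close> from the preceding sweep,
  which the extra summand of \<open>\<Psi> k\<close> cancels exactly. The same summand of
  \<open>\<Psi> (Suc k)\<close> adds to the coefficient of \<open>T (Suc k) N\<close>; what remains
  are, up to sign, the two coefficients whose minimum is \<tau>.\<close>

lemma potential_descent: "\<Psi> (Suc k) \<le> \<Psi> k - \<tau> * S (Suc k)"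
proof -
  let ?c = "(\<beta> - 1 / \<gamma>)\<^sup>2" and ?Q = "\<Sum>i\<in>{1..<N}. T (Suc k) i"
  let ?D = "(norm (lam (Suc (Suc k)) - lam (Suc k)))\<^sup>2"
  have Q: "0 \<le> ?Q" by (simp add: sum_nonneg T_nonneg)
  have AL: "AL (lam (Suc (Suc k))) (x (Suc (Suc k))) \<le> AL (lam (Suc k)) (x (Suc k))
      - \<sigma> / 2 * ?Q + ((\<beta> + L) / 2 - 1 / \<gamma>) * T (Suc k) N + 1 / \<beta> * ?D"
    using AL_multiplier_step[of "Suc k"] AL_last_block[of "Suc k"] AL_manifold_blocks[of "Suc k"]
    by linarith
  have "1 / \<beta> * ?D \<le> 1 / \<beta> * (3 * ?c * T (Suc k) N + 3 * (?c + L\<^sup>2) * T k N + 3 * L\<^sup>2 * L1\<^sup>2 * ?Q)"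
    using multiplier_diff_le \<beta>_pos by (intro mult_left_mono) auto
  also have "\<dots> = 3 / \<beta> * ?c * T (Suc k) N + 3 / \<beta> * (?c + L\<^sup>2) * T k N + 3 / \<beta> * L\<^sup>2 * L1\<^sup>2 * ?Q"
    by (simp add: ring_distribs add_divide_distrib)
  finally have D: "1 / \<beta> * ?D \<le> 3 / \<beta> * ?c * T (Suc k) N
      + 3 / \<beta> * (?c + L\<^sup>2) * T k N + 3 / \<beta> * L\<^sup>2 * L1\<^sup>2 * ?Q" .
  have \<tau>1: "\<tau> * T (Suc k) N \<le>
      - ((\<beta> + L) / 2 - 1 / \<gamma> + 6 / \<beta> * ?c + 3 * L\<^sup>2 / \<beta>) * T (Suc k) N"
    by (intro mult_right_mono) (auto simp: \<tau>_def T_nonneg)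
  have \<tau>2: "\<tau> * ?Q \<le> (\<sigma> / 2 - 3 / \<beta> * L\<^sup>2 * L1\<^sup>2) * ?Q"
    using Q by (intro mult_right_mono) (auto simp: \<tau>_def)
  have n: "(norm (block blk N (x k) - block blk N (x (Suc k))))\<^sup>2 = T k N" for k
    by (simp add: T_N norm_minus_commute)
  have "\<Psi> (Suc k) - \<Psi> k + \<tau> * S (Suc k) \<le>
      - \<sigma> / 2 * ?Q + ((\<beta> + L) / 2 - 1 / \<gamma>) * T (Suc k) N
      + (3 / \<beta> * ?c * T (Suc k) N + 3 / \<beta> * (?c + L\<^sup>2) * T k N + 3 / \<beta> * L\<^sup>2 * L1\<^sup>2 * ?Q)
      + 3 / \<beta> * (?c + L\<^sup>2) * T (Suc k) N - 3 / \<beta> * (?c + L\<^sup>2) * T k N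
      - ((\<beta> + L) / 2 - 1 / \<gamma> + 6 / \<beta> * ?c + 3 * L\<^sup>2 / \<beta>) * T (Suc k) N
      + (\<sigma> / 2 - 3 / \<beta> * L\<^sup>2 * L1\<^sup>2) * ?Q"
    using AL D \<tau>1 \<tau>2 unfolding potential_G_def n S_eq distrib_left[of \<tau>] by linarith
  also have "\<dots> = 0"
    by (simp add: algebra_simps add_divide_distrib)
  finally show ?thesis by simp
qed

end

section \<open>Norm estimates and explicit a priori bounds\<close>

context block_data
begin

abbreviation A_norm :: real where
  "A_norm \<equiv> onorm (\<lambda>y. A *v y)"

lemma norm_mult_le: "norm (A *v y) \<le> A_norm * norm y"
  by (rule onorm) simp

lemma A_norm_nonneg: "0 \<le> A_norm"
  by (rule onorm_pos_le) simp

lemma norm_vector_matrix_le: "norm (l v* A) \<le> A_norm * norm l"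
proof -
  let ?w = "l v* A"
  have "(norm ?w)\<^sup>2 = l \<bullet> (A *v ?w)"
    by (simp add: power2_norm_eq_inner inner_vector_matrix_mult)
  also have "\<dots> \<le> norm l * norm (A *v ?w)" by (rule norm_cauchy_schwarz)
  also have "\<dots> \<le> norm l * (A_norm * norm ?w)"
    using norm_mult_le by (intro mult_left_mono) auto
  finally have "norm ?w * norm ?w \<le> (A_norm * norm l) * norm ?w"
    by (simp add: power2_eq_square mult_ac)
  then show ?thesis
    using A_norm_nonneg by (cases "norm ?w = 0") (auto simp: mult_le_cancel_right)
qed

lemma norm_gradient_f_le: "norm (gradient f y) \<le> norm (gradient f 0) + L * norm y"
  using gradient_f_diff_le[of y 0] norm_triangle_sub[of "gradient f y" "gradient f 0"] by simp

lemma norm_residual_le: "norm (res y) \<le> A_norm * norm y + norm b"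
  using norm_mult_le[of y] norm_triangle_ineq4[of "A *v y" b] by (simp add: residual_eq)

lemma norm_mixed_le: "norm (mixed blk i x' x) \<le> norm x' + norm x"
proof -
  let ?u = "\<chi> c. if blk c < i then x' $ c else 0" and ?v = "\<chi> c. if blk c < i then 0 else x $ c"
  have "mixed blk i x' x = ?u + ?v" by (simp add: vec_eq_iff mixed_nth)
  then have "norm (mixed blk i x' x) \<le> norm ?u + norm ?v" by (metis norm_triangle_ineq)
  also have "\<dots> \<le> norm x' + norm x"
    by (intro add_mono norm_le_componentwise_cart) auto
  finally show ?thesis .
qed

lemma mixed_diff_eq_sum: "mixed blk i x' x - x = (\<Sum>j\<in>{1..<i}. block blk j (x' - x))"
proof -
  have "block blk 0 v = 0" for v :: "real ^ 'n"
  proof -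
    have "blk c \<noteq> 0" for c using blk_bounds(1)[of c] by linarith
    then show ?thesis by (simp only: vec_eq_iff block_nth if_False simp_thms) simp
  qed
  then have "(\<Sum>j<i. block blk j (x' - x)) = (\<Sum>j\<in>{1..<i}. block blk j (x' - x))"
    by (intro sum.mono_neutral_right) (auto simp: Suc_le_eq)
  then show ?thesis by (simp add: mixed_eq_diff_sum)
qed

lemma norm_mixed_diff_le:
  assumes "i \<in> {1..N}"
  shows "(norm (mixed blk i x' x - x))\<^sup>2 \<le> (\<Sum>j\<in>{1..<N}. (norm (block blk j (x' - x)))\<^sup>2)"
proof -
  have "block blk j (mixed blk i x' x - x) = (if j < i then block blk j (x' - x) else 0)" for j
    by (auto simp: vec_eq_iff block_nth mixed_nth)
  then have "(norm (mixed blk i x' x - x))\<^sup>2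
      = (\<Sum>j\<in>{1..N}. if j < i then (norm (block blk j (x' - x)))\<^sup>2 else 0)"
    unfolding norm_eq_sum_block[of "mixed blk i x' x - x"] by (intro sum.cong) auto
  also have "\<dots> = (\<Sum>j\<in>{1..<i}. (norm (block blk j (x' - x)))\<^sup>2)"
    using assms by (intro sum.mono_neutral_cong_right) auto
  also have "\<dots> \<le> (\<Sum>j\<in>{1..<N}. (norm (block blk j (x' - x)))\<^sup>2)"
    using assms by (intro sum_mono2) auto
  finally show ?thesis .
qed

text \<open>Estimating block by block with \<open>A_max\<close> leaves a sum of norms;
  Cauchy-Schwarz turns it into a root of squares and produces the factor \<open>sqrt N\<close> of
  \<kappa>3.\<close>

lemma norm_mult_mixed_diff_le:
  assumes "i \<in> {1..N}"
  shows "norm (A *v (mixed blk i x' x - x))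
    \<le> A_max * (sqrt N * sqrt (\<Sum>j\<in>{1..<N}. (norm (block blk j (x' - x)))\<^sup>2))"
proof -
  let ?d = "\<lambda>j. block blk j (x' - x)"
  have "A *v (mixed blk i x' x - x) = (\<Sum>j\<in>{1..<i}. A *v ?d j)"
    unfolding mixed_diff_eq_sum by (rule vec.linear_sum[OF matrix_vector_mul_linear_gen])
  then have "norm (A *v (mixed blk i x' x - x)) \<le> (\<Sum>j\<in>{1..<i}. norm (A *v ?d j))"
    by (simp add: norm_sum)
  also have "\<dots> \<le> (\<Sum>j\<in>{1..<i}. A_max * norm (?d j))"
    using assms by (intro sum_mono norm_mult_block_le) auto
  also have "\<dots> \<le> (\<Sum>j\<in>{1..<N}. A_max * norm (?d j))"
    using assms A_max_nonneg by (intro sum_mono2) auto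
  also have "\<dots> = A_max * (\<Sum>j\<in>{1..<N}. \<bar>norm (?d j)\<bar>)"
    by (simp add: sum_distrib_left)
  also have "\<dots> \<le> A_max * (sqrt (card {1..<N}) * sqrt (\<Sum>j\<in>{1..<N}. (norm (?d j))\<^sup>2))"
    by (intro mult_left_mono sum_abs_le_sqrt_card A_max_nonneg) auto
  also have "\<dots> \<le> A_max * (sqrt N * sqrt (\<Sum>j\<in>{1..<N}. (norm (?d j))\<^sup>2))"
    by (intro mult_left_mono mult_right_mono A_max_nonneg) (auto simp: sum_nonneg)
  finally show ?thesis .
qed

text \<open>Here \<open>m\<close> bounds the manifold blocks of an iterate, \<open>B\<close> all \<open>S k\<close> with \<open>k \<ge> 1\<close>, and \<open>n\<close> is
  the norm of the first iterate.\<close>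

definition iterate_bound :: "real \<Rightarrow> real \<Rightarrow> real \<Rightarrow> real \<Rightarrow> real" where
  "iterate_bound m \<kappa> B n = m + (sqrt (2 * \<kappa> * B) + norm b + A_norm * m) + (n + sqrt B)"

definition gradient_bound :: "real \<Rightarrow> real \<Rightarrow> real \<Rightarrow> real \<Rightarrow> real \<Rightarrow> real" where
  "gradient_bound \<gamma> m \<kappa> B n =
    (let G = norm (gradient f 0) + L * (2 * iterate_bound m \<kappa> B n)
     in 1 + (G + A_norm * (G + \<bar>\<beta> - 1 / \<gamma>\<bar> * sqrt B)
          + \<beta> * (A_norm * (A_norm * (2 * iterate_bound m \<kappa> B n) + norm b))))"

end

section \<open>Lower bound of the potential, summable steps and bounded iterates\<close>

context algorithm4_run
begin

definition \<kappa>1 :: real where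
  "\<kappa>1 = 3 / \<beta>\<^sup>2 * ((\<beta> - 1 / \<gamma>)\<^sup>2 + L\<^sup>2 * max (L1\<^sup>2) 1)"

text \<open>The middle summand of \<kappa>3. It is the reciprocal of a lower bound for the accepted
  step sizes; see \<open>norm_g_le\<close>.\<close>

definition W :: "real \<Rightarrow> real" where
  "W C = (\<sigma> + 2 * L2 * C + (L + \<beta> * A_max\<^sup>2) * L1\<^sup>2) / (2 * \<alpha>)"

lemma \<kappa>1_nonneg: "0 \<le> \<kappa>1"
  by (simp add: \<kappa>1_def)

text \<open>The multiplier update expresses the indefinite inner product of residual and multiplier
  through a difference of squared multiplier norms, which telescopes over \<open>k\<close>.\<close>

lemma AL_lower_bound:
  "fstar + (norm (lam (Suc k)))\<^sup>2 / (2 * \<beta>) - (norm (lam k))\<^sup>2 / (2 * \<beta>) \<le> AL (lam (Suc k)) (x (Suc k))"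
proof -
  let ?r = "res (x (Suc k))"
  have "lam k = lam (Suc k) + \<beta> *\<^sub>R ?r" by (simp add: last_step(2))
  then have "(norm (lam k))\<^sup>2 = (norm (lam (Suc k)))\<^sup>2 + 2 * \<beta> * (?r \<bullet> lam (Suc k)) + \<beta>\<^sup>2 * (norm ?r)\<^sup>2"
    by (simp only: power2_norm_eq_inner)
      (simp add: inner_add_left inner_add_right inner_commute power2_eq_square)
  then have "(norm (lam (Suc k)))\<^sup>2 / (2 * \<beta>) - (norm (lam k))\<^sup>2 / (2 * \<beta>)
      = - (?r \<bullet> lam (Suc k)) - \<beta> / 2 * (norm ?r)\<^sup>2"
    using \<beta>_pos by (simp add: field_simps power2_eq_square)
  moreover have "0 \<le> \<beta> / 2 * (norm ?r)\<^sup>2" using \<beta>_pos by simp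
  moreover have "fstar \<le> f (x (Suc k))" using f_ge x_mem_manifold_constraint .
  ultimately show ?thesis unfolding aug_lagrangian_def by linarith
qed

lemma AL_le_potential: "AL (lam (Suc k)) (x (Suc k)) \<le> \<Psi> k"
  unfolding potential_G_def using \<beta>_pos by simp

lemma potential_le:
  "\<Psi> (m + n) \<le> \<Psi> m - \<tau> * (\<Sum>j=Suc m..m + n. S j)"
proof (induction n)
  case (Suc n)
  then show ?case
    using potential_descent[of "m + n"] by (simp add: distrib_left)
qed simp

text \<open>By \<open>AL_lower_bound\<close> the sums of \<open>\<Psi> k - fstar\<close> telescope to something bounded below,
  which is impossible if the nonincreasing sequence \<open>\<Psi>\<close> ever drops below \<open>fstar\<close>.\<close>

lemma fstar_le_potential:
  assumes "0 \<le> \<tau>"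
  shows "fstar \<le> \<Psi> m"
proof (rule ccontr)
  assume neg: "\<not> fstar \<le> \<Psi> m"
  define \<delta> where "\<delta> = fstar - \<Psi> m"
  have \<delta>: "\<delta> > 0" using neg by (simp add: \<delta>_def)
  define q where "q k = (norm (lam k))\<^sup>2 / (2 * \<beta>)" for k
  have step: "q (Suc (m + n)) \<le> q (m + n) - \<delta>" for n
  proof -
    have "0 \<le> \<tau> * (\<Sum>j=Suc m..m + n. S j)"
      using assms S_nonneg by (simp add: sum_nonneg)
    then have "\<Psi> (m + n) \<le> \<Psi> m" using potential_le[of m n] by linarith
    then show ?thesis
      using AL_lower_bound[of "m + n"] AL_le_potential[of "m + n"] by (simp add: \<delta>_def q_def)
  qed
  have "q (m + n) \<le> q m - n * \<delta>" for n
  proof (induction n)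
    case (Suc n)
    then show ?case using step[of n] by (simp add: algebra_simps)
  qed simp
  moreover obtain n where "q m < real n * \<delta>"
    using \<delta> reals_Archimedean3 by blast
  moreover have "0 \<le> q (m + n)" using \<beta>_pos by (simp add: q_def)
  ultimately show False by (meson diff_less_0_iff_less leD le_less_trans)
qed

lemma sum_S_le:
  assumes "0 < \<tau>"
  shows "(\<Sum>j=1..n. S j) \<le> (\<Psi> 0 - fstar) / \<tau>"
  using potential_le[of 0 n] fstar_le_potential[of n] assms
  by (simp add: pos_le_divide_eq mult.commute)

lemma S_le:
  assumes "0 < \<tau>" "1 \<le> k"
  shows "S k \<le> (\<Psi> 0 - fstar) / \<tau>"
proof -
  have "S k \<le> (\<Sum>j=1..k. S j)"
    using assms(2) by (intro member_le_sum) (auto simp: S_nonneg)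
  then show ?thesis using sum_S_le[OF assms(1), of k] by linarith
qed

text \<open>Serves for the three shifted sums over the windows, each of which is part of the total
  over indices from 1.\<close>

lemma sum_S_reindex_le:
  assumes "0 < \<tau>" "finite I" "inj_on h I" "\<And>k. k \<in> I \<Longrightarrow> 1 \<le> h k"
  shows "(\<Sum>k\<in>I. S (h k)) \<le> (\<Psi> 0 - fstar) / \<tau>"
proof -
  have "(\<Sum>k\<in>I. S (h k)) = sum S (h ` I)"
    using assms(3) by (simp add: sum.reindex)
  \<comment> \<open>The element 0 keeps the maximum meaningful when \<open>I\<close> is
    empty.\<close>
  also have "\<dots> \<le> sum S {1..Max (h ` I \<union> {0})}"
    using assms(2,4) by (intro sum_mono2) (auto simp: S_nonneg)
  also have "\<dots> \<le> (\<Psi> 0 - fstar) / \<tau>" using sum_S_le[OF assms(1)] .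
  finally show ?thesis .
qed

text \<open>The smallest of \<open>K\<close> windows is at most their average, and each of the three
  shifted sums is at most the total. Starting at 2 keeps \<open>k - 1\<close> at least 1, where the
  total is controlled; a minimiser exists only if the range is nonempty, which forces
  \<open>1 \<le> K\<close>.\<close>

lemma arg_min_S_le:
  fixes K :: int
  assumes "0 < \<tau>"
    and arg_min: "is_arg_min (\<lambda>k. S (k + 1) + S k + S (k - 1)) (\<lambda>k. 2 \<le> k \<and> int k \<le> K + 1) k"
  shows "K * (S (k + 1) + S k + S (k - 1)) \<le> 3 * ((\<Psi> 0 - fstar) / \<tau>)" and "1 \<le> K"
proof -
  let ?\<theta> = "\<lambda>k. S (k + 1) + S k + S (k - 1)" and ?I = "{2..nat K + 1}"
  have k: "2 \<le> k" "int k \<le> K + 1" using arg_min by (auto simp: is_arg_min_def)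
  then show "1 \<le> K" by linarith
  have "?\<theta> k \<le> ?\<theta> j" if "j \<in> ?I" for j
  proof -
    have "2 \<le> j" "int j \<le> K + 1" using that \<open>1 \<le> K\<close> by auto
    then show ?thesis using arg_min unfolding is_arg_min_def by (meson not_le)
  qed
  then have "real (card ?I) * ?\<theta> k \<le> (\<Sum>j\<in>?I. ?\<theta> j)"
    by (intro sum_bounded_below)
  also have "\<dots> = (\<Sum>j\<in>?I. S (j + 1)) + (\<Sum>j\<in>?I. S j) + (\<Sum>j\<in>?I. S (j - 1))"
    by (simp add: sum.distrib)
  also have "\<dots> \<le> (\<Psi> 0 - fstar) / \<tau> + (\<Psi> 0 - fstar) / \<tau> + (\<Psi> 0 - fstar) / \<tau>"
    by (intro add_mono sum_S_reindex_le[OF assms(1)]) (auto simp: inj_on_def)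
  finally have "real (card ?I) * ?\<theta> k \<le> 3 * ((\<Psi> 0 - fstar) / \<tau>)" by linarith
  then show "K * ?\<theta> k \<le> 3 * ((\<Psi> 0 - fstar) / \<tau>)"
    using \<open>1 \<le> K\<close> by simp
qed

text \<open>The residual is the multiplier increment divided by \<open>- \<beta>\<close>, and
  \<open>\<kappa>1\<close> dominates every coefficient in \<open>multiplier_diff_le\<close> after
  division by \<open>\<beta>\<^sup>2\<close>.\<close>

lemma residual_le:
  "(norm (res (x (Suc (Suc k)))))\<^sup>2 \<le> \<kappa>1 * (S (Suc k) + S k)"
proof -
  let ?c = "(\<beta> - 1 / \<gamma>)\<^sup>2" and ?Q = "\<Sum>i\<in>{1..<N}. T (Suc k) i"
  let ?m = "?c + L\<^sup>2 * max (L1\<^sup>2) 1"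
  have Q: "0 \<le> ?Q" by (simp add: sum_nonneg T_nonneg)
  have "L\<^sup>2 * 1 \<le> L\<^sup>2 * max (L1\<^sup>2) 1" "L\<^sup>2 * L1\<^sup>2 \<le> L\<^sup>2 * max (L1\<^sup>2) 1"
    by (intro mult_left_mono; simp)+
  then have m: "?c \<le> ?m" "?c + L\<^sup>2 \<le> ?m" "L\<^sup>2 * L1\<^sup>2 \<le> ?m" "0 \<le> ?m"
    by (auto intro: add_increasing)
  have "lam (Suc (Suc k)) - lam (Suc k) = - \<beta> *\<^sub>R res (x (Suc (Suc k)))"
    by (simp add: last_step(2))
  then have "\<beta>\<^sup>2 * (norm (res (x (Suc (Suc k)))))\<^sup>2 = (norm (lam (Suc (Suc k)) - lam (Suc k)))\<^sup>2"
    by (simp add: power_mult_distrib)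
  also have "\<dots> \<le> 3 * (?c * T (Suc k) N) + 3 * ((?c + L\<^sup>2) * T k N) + 3 * (L\<^sup>2 * L1\<^sup>2 * ?Q)"
    using multiplier_diff_le[of k] by (simp only: mult.assoc)
  also have "\<dots> \<le> 3 * (?m * T (Suc k) N) + 3 * (?m * S k) + 3 * (?m * ?Q)"
    using m Q T_le_S[of N k] N_ge_1
    by (intro add_mono mult_left_mono mult_mono) (simp_all add: T_nonneg)
  also have "\<dots> = \<beta>\<^sup>2 * (\<kappa>1 * (S (Suc k) + S k))"
    using \<beta>_pos unfolding S_eq[of "Suc k"] \<kappa>1_def by (simp add: field_simps)
  finally show ?thesis using \<beta>_pos by simp
qed

text \<open>Compactness bounds the manifold part by \<open>m\<close>. The last block is recovered
  isometrically from the residual, \<open>b\<close> and the image of the manifold part, so a bounded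
  residual bounds it too.\<close>

lemma norm_x_le:
  assumes "0 < \<tau>" and B: "B = (\<Psi> 0 - fstar) / \<tau>"
    and m: "\<And>y. y \<in> manifold_constraint blk N M \<Longrightarrow> norm (y - block blk N y) \<le> m" and "2 \<le> k"
  shows "norm (x k) \<le> iterate_bound m \<kappa>1 B (norm (x 1))"
proof -
  let ?w = "x k - block blk N (x k)"
  have w: "norm ?w \<le> m" using m x_mem_manifold_constraint .
  have m0: "0 \<le> m" using norm_ge_zero w by (rule order_trans)
  have B0: "0 \<le> B" using B fstar_le_potential[of 0] assms(1) by simp
  have pos: "0 \<le> sqrt (2 * \<kappa>1 * B) + norm b + A_norm * m" "0 \<le> norm (x 1) + sqrt B"
    using B0 \<kappa>1_nonneg m0 A_norm_nonneg by auto
  have "norm (block blk N (x k)) \<le> (sqrt (2 * \<kappa>1 * B) + norm b + A_norm * m) + (norm (x 1) + sqrt B)"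
  proof (cases "k = 2")
    \<comment> \<open>The residual estimate for the second iterate would involve \<open>S 0\<close>,
      which the summability bound does not cover. The second iterate is therefore reached from the
      first by one step of length at most \<open>sqrt B\<close>.\<close>
    case True
    have "norm (dN 1) \<le> sqrt B"
      unfolding B using S_le[OF assms(1), of 1] T_le_S[of N 1] N_ge_1
      by (intro real_le_rsqrt) (simp add: T_N)
    moreover have "norm (block blk N (x 2)) \<le> norm (block blk N (x 1)) + norm (dN 1)"
      using norm_triangle_ineq[of "block blk N (x 1)" "dN 1"] by (simp add: numeral_2_eq_2)
    ultimately have "norm (block blk N (x 2)) \<le> norm (x 1) + sqrt B"
      using norm_block_le[of blk N "x 1"] by linarith
    then show ?thesis unfolding True using pos(1) by linarith
  next
    case False
    then obtain j where j: "k = Suc (Suc j)" "1 \<le> j"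
      using assms(4) by (metis One_nat_def Suc_1 Suc_leI Suc_le_D le_neq_implies_less Suc_le_mono)
    have "(norm (res (x k)))\<^sup>2 \<le> \<kappa>1 * (B + B)"
      using residual_le[of j] S_le[OF assms(1), of "Suc j"] S_le[OF assms(1), of j] j \<kappa>1_nonneg
      unfolding j B by (meson add_mono le_SucI mult_left_mono order_trans)
    then have r: "norm (res (x k)) \<le> sqrt (2 * \<kappa>1 * B)"
      by (intro real_le_rsqrt) (simp add: algebra_simps)
    have "A *v block blk N (x k) = res (x k) + b - A *v ?w"
      by (simp add: residual_eq matrix_vector_mult_diff_distrib)
    then have "norm (block blk N (x k)) = norm (res (x k) + b - A *v ?w)"
      by (metis norm_mult_block_N)
    also have "\<dots> \<le> norm (res (x k)) + norm b + norm (A *v ?w)"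
      using norm_triangle_ineq4[of "res (x k) + b" "A *v ?w"] norm_triangle_ineq[of "res (x k)" b]
      by linarith
    also have "norm (A *v ?w) \<le> A_norm * m"
      using norm_mult_le[of ?w] mult_left_mono[OF w A_norm_nonneg] by linarith
    finally show ?thesis using r pos(2) by linarith
  qed
  then show ?thesis
    using norm_triangle_ineq[of ?w "block blk N (x k)"] w unfolding iterate_bound_def by simp
qed

text \<open>The multiplier is bounded through \<open>multiplier_eq\<close> one sweep earlier. That
  sweep needs index at least 2 for \<open>norm_x_le\<close>, hence \<open>3 \<le> k\<close>.\<close>

lemma norm_GAL_le:
  assumes \<tau>: "0 < \<tau>" and B: "B = (\<Psi> 0 - fstar) / \<tau>"
    and m: "\<And>y. y \<in> manifold_constraint blk N M \<Longrightarrow> norm (y - block blk N y) \<le> m" and "3 \<le> k"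
  shows "norm (GAL (lam k) (z k i)) < gradient_bound \<gamma> m \<kappa>1 B (norm (x 1))"
proof -
  let ?X = "iterate_bound m \<kappa>1 B (norm (x 1))"
  let ?G = "norm (gradient f 0) + L * (2 * ?X)"
  have z: "norm (z j i) \<le> 2 * ?X" if "2 \<le> j" for j i
    using norm_mixed_le[of i "x (Suc j)" "x j"] norm_x_le[OF \<tau> B m, of j]
      norm_x_le[OF \<tau> B m, of "Suc j"] that by simp
  have G: "norm (gradient f (z j i)) \<le> ?G" if "2 \<le> j" for j i
    using norm_gradient_f_le[of "z j i"] mult_left_mono[OF z[OF that, of i] less_imp_le[OF L_pos]]
    by linarith
  obtain j where j: "k = Suc j" "2 \<le> j" using assms(4) by (cases k) auto
  have dN: "norm (dN j) \<le> sqrt B"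
    unfolding B using S_le[OF \<tau>, of j] T_le_S[of N j] N_ge_1 j(2)
    by (intro real_le_rsqrt) (simp add: T_N)
  have "norm (lam k) = norm (block blk N (gradient f (z j N)) - (\<beta> - 1 / \<gamma>) *\<^sub>R dN j)"
    using multiplier_eq[of j] norm_block_N_vector_matrix[of "lam k"] j(1) by simp
  also have "\<dots> \<le> norm (gradient f (z j N)) + \<bar>\<beta> - 1 / \<gamma>\<bar> * norm (dN j)"
    using norm_triangle_ineq4[of "block blk N (gradient f (z j N))" "(\<beta> - 1 / \<gamma>) *\<^sub>R dN j"]
      norm_block_le[of blk N "gradient f (z j N)"] by simp
  also have "\<dots> \<le> ?G + \<bar>\<beta> - 1 / \<gamma>\<bar> * sqrt B"
    using G[OF j(2)] dN by (intro add_mono mult_left_mono) auto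
  finally have lam: "norm (lam k v* A) \<le> A_norm * (?G + \<bar>\<beta> - 1 / \<gamma>\<bar> * sqrt B)"
    using norm_vector_matrix_le[of "lam k"] A_norm_nonneg by (meson mult_left_mono order_trans)
  have "norm (res (z k i)) \<le> A_norm * (2 * ?X) + norm b"
    using norm_residual_le[of "z k i"] mult_left_mono[OF z[of k i] A_norm_nonneg] assms(4) by simp
  then have "norm (res (z k i) v* A) \<le> A_norm * (A_norm * (2 * ?X) + norm b)"
    using norm_vector_matrix_le[of "res (z k i)"] A_norm_nonneg by (meson mult_left_mono order_trans)
  then have r: "norm (\<beta> *\<^sub>R (res (z k i) v* A)) \<le> \<beta> * (A_norm * (A_norm * (2 * ?X) + norm b))"
    using \<beta>_pos by simp
  have "norm (GAL (lam k) (z k i)) \<le> norm (gradient f (z k i)) + norm (lam k v* A)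
      + norm (\<beta> *\<^sub>R (res (z k i) v* A))"
    unfolding GAL_def
    using norm_triangle_ineq[of "gradient f (z k i) - lam k v* A" "\<beta> *\<^sub>R (res (z k i) v* A)"]
      norm_triangle_ineq4[of "gradient f (z k i)" "lam k v* A"] by linarith
  then show ?thesis
    using G[of k i] lam r assms(4) unfolding gradient_bound_def Let_def by linarith
qed

section \<open>Backtracking and bounds for the stationarity measures\<close>

lemma retraction_mem:
  assumes "i \<in> {1..<N}"
  shows "R i (block blk i (x k)) (- u *\<^sub>R g k i) \<in> block_space blk i"
proof -
  have "- u *\<^sub>R g k i \<in> tangent_space (M i) (block blk i (x k))"
    using subspace_scale[OF subspace_tangent[OF assms] uminus_g_tangent[OF assms], of u] by simp
  then have "R i (block blk i (x k)) (- u *\<^sub>R g k i) \<in> M i"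
    using R_retraction[OF assms] block_mem_M[OF assms] unfolding manifold_retraction_def by blast
  then show ?thesis using M_ambient[OF assms] by blast
qed

text \<open>Split the displacement \<open>d\<close> into \<open>- u *\<^sub>R g k i\<close> and a
  retraction error. The first part yields exact descent because \<open>g k i\<close> is the
  projection of the partial gradient; the error is quadratic in \<open>u\<close> and is weighted by
  the gradient bound \<open>C\<close>. The curvature terms use the first retraction bound.\<close>

lemma AL_trial_le:
  assumes i: "i \<in> {1..<N}" and u: "0 \<le> u" and C: "norm (GAL (lam k) (z k i)) \<le> C"
  shows "AL (lam k) (put_block blk i (R i (block blk i (x k)) (- u *\<^sub>R g k i)) (z k i))
    \<le> AL (lam k) (z k i) - u * (norm (g k i))\<^sup>2
       + (L2 * C + (L + \<beta> * A_max\<^sup>2) * L1\<^sup>2 / 2) * (u\<^sup>2 * (norm (g k i))\<^sup>2)"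
proof -
  let ?n = "norm (g k i)" and ?G = "GAL (lam k) (z k i)"
  define d where "d = R i (block blk i (x k)) (- u *\<^sub>R g k i) - block blk i (x k)"
  have bd: "block blk i d = d"
    unfolding d_def block_diff block_eq_self[OF retraction_mem[OF i]] by (simp add: block_block)
  have put: "put_block blk i (R i (block blk i (x k)) (- u *\<^sub>R g k i)) (z k i) = z k i + d"
    unfolding put_block_eq_add[OF retraction_mem[OF i]] by (simp add: d_def)
  have nd: "(norm d)\<^sup>2 \<le> L1\<^sup>2 * (u\<^sup>2 * ?n\<^sup>2)"
  proof -
    have "norm d \<le> L1 * u * ?n" unfolding d_def using norm_retraction_diff_le(1)[OF i u] .
    then have "(norm d)\<^sup>2 \<le> (L1 * u * ?n)\<^sup>2" by (rule power_mono) simp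
    then show ?thesis by (simp add: power_mult_distrib mult.assoc)
  qed
  have "norm (A *v d) \<le> A_max * norm d"
    using norm_mult_block_le[of i d] i unfolding bd by auto
  then have "(norm (A *v d))\<^sup>2 \<le> (A_max * norm d)\<^sup>2" by (rule power_mono) simp
  then have "L / 2 * (norm d)\<^sup>2 + \<beta> / 2 * (norm (A *v d))\<^sup>2
      \<le> L / 2 * (norm d)\<^sup>2 + \<beta> / 2 * (A_max\<^sup>2 * (norm d)\<^sup>2)"
    using \<beta>_pos by (simp add: power_mult_distrib)
  also have "\<dots> = (L + \<beta> * A_max\<^sup>2) / 2 * (norm d)\<^sup>2" by (simp add: algebra_simps add_divide_distrib)
  also have "\<dots> \<le> (L + \<beta> * A_max\<^sup>2) / 2 * (L1\<^sup>2 * (u\<^sup>2 * ?n\<^sup>2))"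
    using nd L_pos \<beta>_pos by (intro mult_left_mono) auto
  finally have quad: "L / 2 * (norm d)\<^sup>2 + \<beta> / 2 * (norm (A *v d))\<^sup>2
      \<le> (L + \<beta> * A_max\<^sup>2) * L1\<^sup>2 / 2 * (u\<^sup>2 * ?n\<^sup>2)" by (simp add: mult.assoc)
  have g: "block blk i ?G \<bullet> g k i = ?n\<^sup>2"
    unfolding block_step(1)[OF i] tangent_proj_z
    by (rule inner_closest_point_subspace[OF subspace_tangent[OF i]])
  have "?G \<bullet> d = block blk i ?G \<bullet> (d + u *\<^sub>R g k i) - u * ?n\<^sup>2"
    by (metis (no_types) bd inner_block add_diff_cancel_right' g inner_add_right inner_scaleR_right)
  also have "block blk i ?G \<bullet> (d + u *\<^sub>R g k i) \<le> norm (block blk i ?G) * norm (d + u *\<^sub>R g k i)"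
    by (rule norm_cauchy_schwarz)
  also have "\<dots> \<le> C * (L2 * u\<^sup>2 * ?n\<^sup>2)"
  proof (rule mult_mono)
    show "norm (block blk i ?G) \<le> C" using norm_block_le C by (rule order_trans)
    show "norm (d + u *\<^sub>R g k i) \<le> L2 * u\<^sup>2 * ?n\<^sup>2"
      unfolding d_def using norm_retraction_diff_le(2)[OF i u] .
    show "0 \<le> C" using norm_ge_zero C by (rule order_trans)
  qed simp
  finally have "?G \<bullet> d \<le> L2 * C * (u\<^sup>2 * ?n\<^sup>2) - u * ?n\<^sup>2" by (simp add: mult_ac)
  then show ?thesis
    unfolding put distrib_right[of _ _ "_ * _"] using AL_upper_bound[of "lam k" "z k i" d] quad
    by linarith
qed

text \<open>The core is \<open>1 \<le> W C * t k i\<close>, a lower bound for the accepted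
  step.\<close>

lemma norm_g_le:
  assumes i: "i \<in> {1..<N}" and C: "norm (GAL (lam k) (z k i)) \<le> C" and \<sigma>: "2 * \<alpha> / s < \<sigma>"
  shows "norm (g k i) \<le> W C * sqrt (S k)"
proof -
  let ?n = "norm (g k i)"
  have C0: "0 \<le> C" using norm_ge_zero C by (rule order_trans)
  have E: "0 \<le> 2 * L2 * C" "0 \<le> (L + \<beta> * A_max\<^sup>2) * L1\<^sup>2"
    using C0 L2_pos L_pos \<beta>_pos by simp_all
  have W0: "0 \<le> W C" using E \<sigma>_pos \<alpha>_pos by (simp add: W_def)
  have "?n \<le> W C * (t k i * ?n)"
  proof (cases "?n = 0")
    case False
    then have n: "?n > 0" by simp
    obtain j where j: "t k i = s * \<alpha> ^ j" and fail: "\<And>l. l < j \<Longrightarrow>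
      AL (lam k) (put_block blk i (R i (block blk i (x k)) (- (s * \<alpha> ^ l) *\<^sub>R g k i)) (z k i))
        > AL (lam k) (z k i) - \<sigma> / 2 * (s * \<alpha> ^ l)\<^sup>2 * ?n\<^sup>2"
      using block_step(3)[OF i, of k] by blast
    have "1 \<le> W C * t k i"
    proof (cases j)
      \<comment> \<open>No trial was rejected, so the step is \<open>s\<close> and the assumption on
        \<sigma> is enough.\<close>
      case 0
      have "2 * \<alpha> < (\<sigma> + 2 * L2 * C + (L + \<beta> * A_max\<^sup>2) * L1\<^sup>2) * s"
      proof -
        have "2 * \<alpha> < \<sigma> * s" using \<sigma> s_pos by (simp add: pos_divide_less_eq)
        also have "\<dots> \<le> (\<sigma> + 2 * L2 * C + (L + \<beta> * A_max\<^sup>2) * L1\<^sup>2) * s"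
          using E s_pos by (intro mult_right_mono) auto
        finally show ?thesis .
      qed
      then show ?thesis using 0 j \<alpha>_pos by (simp add: W_def pos_le_divide_eq)
    next
      \<comment> \<open>\<open>?u\<close> is the last rejected step, that is
        \<open>t k i / \<alpha>\<close>. Its failed decrease test contradicts
        \<open>AL_trial_le\<close> unless \<open>?u\<close> is large enough.\<close>
      case (Suc l)
      let ?u = "s * \<alpha> ^ l" and ?w = "L2 * C + (L + \<beta> * A_max\<^sup>2) * L1\<^sup>2 / 2"
      have u: "0 < ?u" using s_pos \<alpha>_pos by simp
      have "?u * ?n\<^sup>2 < (\<sigma> / 2 + ?w) * (?u\<^sup>2 * ?n\<^sup>2)"
        using fail[of l] Suc AL_trial_le[OF i less_imp_le[OF u] C]
        by (simp only: distrib_right mult.assoc) linarith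
      also have "\<dots> = (\<sigma> / 2 + ?w) * ?u * (?u * ?n\<^sup>2)" by (simp add: power2_eq_square)
      finally have "1 * (?u * ?n\<^sup>2) < (\<sigma> / 2 + ?w) * ?u * (?u * ?n\<^sup>2)" by simp
      then have "1 < (\<sigma> / 2 + ?w) * ?u"
        using u n by (subst (asm) mult_less_cancel_right_pos) auto
      also have "\<dots> = W C * t k i"
        using \<alpha>_pos j Suc by (simp add: W_def field_simps)
      finally show ?thesis by simp
    qed
    then show ?thesis using n by (simp flip: mult.assoc)
  qed simp
  also have "t k i * ?n = sqrt (T k i)"
    using t_pos[OF i, of k] by (simp add: T_def)
  also have "W C * sqrt (T k i) \<le> W C * sqrt (S k)"
    using W0 T_le_S[of i k] i by (intro mult_left_mono) auto
  finally show ?thesis .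
qed

text \<open>\<open>multiplier_eq\<close> involves the gradient at \<open>z k N\<close>, which
  differs from the new iterate only by \<open>dN k\<close>; Lipschitz continuity pays for the
  change.\<close>

lemma norm_last_gradient_le:
  "(norm (block blk N (gradient f (x (Suc k)) - lam (Suc k) v* A)))\<^sup>2
    \<le> (\<bar>\<beta> - 1 / \<gamma>\<bar> + L)\<^sup>2 * S k"
proof -
  let ?v = "block blk N (gradient f (x (Suc k)) - gradient f (z k N))"
  have "block blk N (gradient f (x (Suc k)) - lam (Suc k) v* A) = ?v + (\<beta> - 1 / \<gamma>) *\<^sub>R dN k"
    unfolding block_diff multiplier_eq by simp
  then have "norm (block blk N (gradient f (x (Suc k)) - lam (Suc k) v* A))
      \<le> norm ?v + \<bar>\<beta> - 1 / \<gamma>\<bar> * norm (dN k)"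
    by (metis norm_scaleR norm_triangle_ineq real_norm_def)
  also have "norm ?v \<le> L * norm (x (Suc k) - z k N)"
    using norm_block_le gradient_f_diff_le by (rule order_trans)
  also have "x (Suc k) - z k N = dN k" by (simp add: z_N)
  finally have "norm (block blk N (gradient f (x (Suc k)) - lam (Suc k) v* A))
      \<le> (\<bar>\<beta> - 1 / \<gamma>\<bar> + L) * norm (dN k)"
    by (simp add: algebra_simps)
  then have "(norm (block blk N (gradient f (x (Suc k)) - lam (Suc k) v* A)))\<^sup>2
      \<le> ((\<bar>\<beta> - 1 / \<gamma>\<bar> + L) * norm (dN k))\<^sup>2"
    by (rule power_mono) simp
  also have "\<dots> = (\<bar>\<beta> - 1 / \<gamma>\<bar> + L)\<^sup>2 * T k N" by (simp add: power_mult_distrib T_N)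
  also have "\<dots> \<le> (\<bar>\<beta> - 1 / \<gamma>\<bar> + L)\<^sup>2 * S k"
    using T_le_S[of N k] N_ge_1 by (intro mult_left_mono) auto
  finally show ?thesis .
qed

text \<open>Compare with the algorithm's own gradient \<open>g\<close> at the same index. The three
  summands of the constant come from the change of point between the iterate and the mixed point,
  from the norm of \<open>g\<close>, and from the penalty term at the iterate's residual.\<close>

lemma norm_tangent_gradient_le:
  assumes i: "i \<in> {1..<N}" and C: "norm (GAL (lam (Suc (Suc k))) (z (Suc (Suc k)) i)) \<le> C"
    and \<sigma>: "2 * \<alpha> / s < \<sigma>"
    and \<theta>: "\<theta> = S (Suc (Suc k)) + S (Suc k) + S k"
  shows "norm (tangent_proj blk M i (x (Suc (Suc k)))
      (block blk i (gradient f (x (Suc (Suc k))) - lam (Suc (Suc k)) v* A)))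
    \<le> ((L + sqrt N * \<beta> * A_max\<^sup>2) * max L1 1 + W C + \<beta> * A_max * sqrt \<kappa>1) * sqrt \<theta>"
proof -
  let ?p = "Suc (Suc k)"
  let ?T = "tangent_space (M i) (block blk i (x ?p))"
  let ?u = "block blk i (gradient f (x ?p) - lam ?p v* A)"
    and ?v = "block blk i (GAL (lam ?p) (z ?p i))"
  let ?e = "z ?p i - x ?p"
  have iN: "i \<in> {1..N}" using i by auto
  have S_le: "S ?p \<le> \<theta>" "S (Suc k) + S k \<le> \<theta>" using S_nonneg by (auto simp: \<theta>)
  have \<theta>0: "0 \<le> \<theta>" using S_nonneg by (simp add: \<theta>)
  let ?Q = "\<Sum>j\<in>{1..<N}. (norm (block blk j (x (Suc ?p) - x ?p)))\<^sup>2"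
  have "?Q \<le> (\<Sum>j\<in>{1..<N}. L1\<^sup>2 * T ?p j)"
    by (intro sum_mono norm_block_diff_le)
  also have "\<dots> \<le> L1\<^sup>2 * S ?p"
    unfolding S_eq by (simp add: sum_distrib_left distrib_left T_nonneg)
  also have "\<dots> \<le> (max L1 1)\<^sup>2 * \<theta>"
    using S_le L1_pos S_nonneg by (intro mult_mono power_mono) auto
  finally have Q: "sqrt ?Q \<le> max L1 1 * sqrt \<theta>"
    using \<theta>0 by (intro real_le_lsqrt) (auto simp: power_mult_distrib)
  have "norm ?e \<le> sqrt ?Q"
    using norm_mixed_diff_le[OF iN] by (rule real_le_rsqrt)
  then have e: "norm ?e \<le> max L1 1 * sqrt \<theta>" using Q by linarith
  have "norm (A *v ?e) \<le> A_max * (sqrt N * sqrt ?Q)"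
    by (rule norm_mult_mixed_diff_le[OF iN])
  also have "\<dots> \<le> A_max * (sqrt N * (max L1 1 * sqrt \<theta>))"
    using Q A_max_nonneg by (intro mult_left_mono) auto
  finally have Ae: "norm (A *v ?e) \<le> A_max * (sqrt N * (max L1 1 * sqrt \<theta>))" .
  have r: "norm (res (x ?p)) \<le> sqrt \<kappa>1 * sqrt \<theta>"
    unfolding real_sqrt_mult[symmetric]
    using residual_le[of k] mult_left_mono[OF S_le(2) \<kappa>1_nonneg]
    by (intro real_le_rsqrt) linarith
  have res_z: "res (z ?p i) = res (x ?p) + A *v ?e"
    using residual_add[of "x ?p" ?e] by simp
  have rz: "norm (res (z ?p i)) \<le> sqrt \<kappa>1 * sqrt \<theta> + A_max * (sqrt N * (max L1 1 * sqrt \<theta>))"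
    unfolding res_z using r Ae norm_triangle_ineq[of "res (x ?p)" "A *v ?e"] by linarith
  have "?u - ?v = block blk i (gradient f (x ?p) - gradient f (z ?p i))
      - \<beta> *\<^sub>R block blk i (res (z ?p i) v* A)"
    by (simp add: GAL_def block_diff block_add block_scaleR)
  then have "norm (?u - ?v) \<le> norm (block blk i (gradient f (x ?p) - gradient f (z ?p i)))
      + \<beta> * norm (block blk i (res (z ?p i) v* A))"
    using norm_triangle_ineq4[of "block blk i (gradient f (x ?p) - gradient f (z ?p i))"
      "\<beta> *\<^sub>R block blk i (res (z ?p i) v* A)"] \<beta>_pos by simp
  also have "\<dots> \<le> L * (max L1 1 * sqrt \<theta>)
      + \<beta> * (A_max * (sqrt \<kappa>1 * sqrt \<theta> + A_max * (sqrt N * (max L1 1 * sqrt \<theta>))))"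
  proof (intro add_mono mult_left_mono)
    have "norm (block blk i (gradient f (x ?p) - gradient f (z ?p i))) \<le> L * norm (x ?p - z ?p i)"
      using norm_block_le gradient_f_diff_le by (rule order_trans)
    also have "\<dots> \<le> L * (max L1 1 * sqrt \<theta>)"
      using e L_pos by (simp add: norm_minus_commute)
    finally show "norm (block blk i (gradient f (x ?p) - gradient f (z ?p i))) \<le> L * (max L1 1 * sqrt \<theta>)" .
    show "norm (block blk i (res (z ?p i) v* A))
        \<le> A_max * (sqrt \<kappa>1 * sqrt \<theta> + A_max * (sqrt N * (max L1 1 * sqrt \<theta>)))"
      using norm_block_vector_matrix_le[OF iN] mult_left_mono[OF rz A_max_nonneg]
      by (rule order_trans)
  qed (use \<beta>_pos in simp)
  finally have uv: "norm (?u - ?v) \<le> \<dots>" .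
  have "norm (closest_point ?T ?u) \<le> norm (g ?p i) + norm (closest_point ?T ?u - g ?p i)"
    using norm_triangle_sub[of "closest_point ?T ?u" "g ?p i"] by simp
  \<comment> \<open>Block \<open>i\<close> of the mixed point is still that of the iterate, so both
    vectors are projected onto the same tangent space and nonexpansiveness applies.\<close>
  also have "norm (closest_point ?T ?u - g ?p i) \<le> norm (?u - ?v)"
    unfolding block_step(1)[OF i] tangent_proj_z
    by (rule norm_closest_point_subspace_diff[OF subspace_tangent[OF i]])
  also have "norm (g ?p i) \<le> W C * sqrt \<theta>"
  proof -
    have "0 \<le> C" using norm_ge_zero C by (rule order_trans)
    then have "0 \<le> W C" using \<sigma>_pos L2_pos L_pos \<beta>_pos \<alpha>_pos by (simp add: W_def)
    then have "W C * sqrt (S ?p) \<le> W C * sqrt \<theta>" using S_le by (intro mult_left_mono) auto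
    then show ?thesis using norm_g_le[OF i C \<sigma>] by linarith
  qed
  finally have "norm (closest_point ?T ?u) \<le> W C * sqrt \<theta> + (L * (max L1 1 * sqrt \<theta>)
      + \<beta> * (A_max * (sqrt \<kappa>1 * sqrt \<theta> + A_max * (sqrt N * (max L1 1 * sqrt \<theta>)))))"
    using uv by linarith
  also have "\<dots> = ((L + sqrt N * \<beta> * A_max\<^sup>2) * max L1 1 + W C + \<beta> * A_max * sqrt \<kappa>1) * sqrt \<theta>"
    by (simp add: algebra_simps power2_eq_square)
  finally show ?thesis by (simp add: tangent_proj_def)
qed

end

text \<open>This bound depends on the manifolds alone, so it can be fixed before any run is
  considered.\<close>

lemma (in block_data) norm_manifold_part_bounded:
  assumes "\<And>i. i \<in> {1..<N} \<Longrightarrow> bounded (M i)"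
  obtains m where "\<And>y. y \<in> manifold_constraint blk N M \<Longrightarrow> norm (y - block blk N y) \<le> m"
proof -
  have "\<forall>i\<in>{1..<N}. \<exists>r. \<forall>v\<in>M i. norm v \<le> r"
    using assms by (simp add: bounded_iff)
  then obtain r where r: "\<And>i v. i \<in> {1..<N} \<Longrightarrow> v \<in> M i \<Longrightarrow> norm v \<le> r i"
    by metis
  have "norm (y - block blk N y) \<le> (\<Sum>i\<in>{1..<N}. r i)" if "y \<in> manifold_constraint blk N M" for y
  proof -
    have "(\<Sum>i=1..N. block blk i y) = (\<Sum>i\<in>{1..<N}. block blk i y) + block blk N y"
      using N_ge_1 by (simp add: atLeastLessThanSuc_atLeastAtMost[symmetric])
    then have "y - block blk N y = (\<Sum>i\<in>{1..<N}. block blk i y)"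
      by (simp only: sum_block diff_eq_eq)
    also have "norm \<dots> \<le> (\<Sum>i\<in>{1..<N}. r i)"
      using r that by (intro sum_norm_le) (auto simp: manifold_constraint_def)
    finally show ?thesis .
  qed
  then show ?thesis by (rule that)
qed

section \<open>From a small window to stationarity, and the parameter conditions\<close>

lemma (in algorithm4_run) eps_stationary_if_le:
  assumes "0 < \<epsilon>" and \<theta>: "\<theta> = S (Suc (Suc k)) + S (Suc k) + S k"
    and \<sigma>: "2 * \<alpha> / s < \<sigma>"
    and C: "\<And>i. norm (GAL (lam (Suc (Suc k))) (z (Suc (Suc k)) i)) \<le> C"
    and \<kappa>3: "\<kappa>3 = ((L + sqrt N * \<beta> * A_max\<^sup>2) * max L1 1 + W C + \<beta> * A_max * sqrt \<kappa>1)\<^sup>2"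
    and le: "max \<kappa>1 (max ((\<bar>\<beta> - 1 / \<gamma>\<bar> + L)\<^sup>2) \<kappa>3) * \<theta> \<le> \<epsilon>\<^sup>2"
  shows "eps_stationary blk N A b f M \<epsilon> (x (Suc (Suc k))) (lam (Suc (Suc k)))"
proof -
  let ?p = "Suc (Suc k)" and ?\<kappa> = "max \<kappa>1 (max ((\<bar>\<beta> - 1 / \<gamma>\<bar> + L)\<^sup>2) \<kappa>3)"
  have S_le: "S (Suc k) + S k \<le> \<theta>" "S (Suc k) \<le> \<theta>" using S_nonneg by (auto simp: \<theta>)
  have \<theta>0: "0 \<le> \<theta>" using S_nonneg by (simp add: \<theta>)
  have le1: "\<kappa>1 * \<theta> \<le> \<epsilon>\<^sup>2" and le2: "(\<bar>\<beta> - 1 / \<gamma>\<bar> + L)\<^sup>2 * \<theta> \<le> \<epsilon>\<^sup>2" and le3: "\<kappa>3 * \<theta> \<le> \<epsilon>\<^sup>2"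
    by (rule order_trans[OF mult_right_mono[OF _ \<theta>0] le]; simp)+
  have pg: "partial_gradient blk i f (x ?p) - transpose (col_block blk A i) *v lam ?p
      = block blk i (gradient f (x ?p) - lam ?p v* A)" for i
    by (simp only: partial_gradient_def transpose_col_block_mult block_diff)
  have "(norm (res (x ?p)))\<^sup>2 \<le> \<epsilon>\<^sup>2"
    using residual_le[of k] mult_left_mono[OF S_le(1) \<kappa>1_nonneg] le1 by linarith
  then have res: "norm (res (x ?p)) \<le> \<epsilon>"
    using assms(1) by (simp add: power2_le_iff_abs_le)
  have "(norm (block blk N (gradient f (x ?p) - lam ?p v* A)))\<^sup>2 \<le> \<epsilon>\<^sup>2"
    using norm_last_gradient_le[of "Suc k"] mult_left_mono[OF S_le(2), of "(\<bar>\<beta> - 1 / \<gamma>\<bar> + L)\<^sup>2"] le2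
    by simp
  then have last: "norm (block blk N (gradient f (x ?p) - lam ?p v* A)) \<le> \<epsilon>"
    using assms(1) by (simp add: power2_le_iff_abs_le)
  have "norm (tangent_proj blk M i (x ?p) (block blk i (gradient f (x ?p) - lam ?p v* A))) \<le> \<epsilon>"
    if "i \<in> {1..<N}" for i
  proof -
    let ?k = "(L + sqrt N * \<beta> * A_max\<^sup>2) * max L1 1 + W C + \<beta> * A_max * sqrt \<kappa>1"
    have "norm (tangent_proj blk M i (x ?p) (block blk i (gradient f (x ?p) - lam ?p v* A)))
        \<le> ?k * sqrt \<theta>"
      by (rule norm_tangent_gradient_le[OF that C \<sigma> \<theta>])
    also have "\<dots> \<le> \<bar>?k * sqrt \<theta>\<bar>" by simp
    also have "\<dots> \<le> \<epsilon>"
    proof (rule power2_le_imp_le)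
      show "\<bar>?k * sqrt \<theta>\<bar>\<^sup>2 \<le> \<epsilon>\<^sup>2"
        using le3 \<theta>0 unfolding \<kappa>3 power2_abs power_mult_distrib by simp
    qed (use assms(1) in simp)
    finally show ?thesis .
  qed
  then show ?thesis
    unfolding eps_stationary_def pg using x_mem_manifold_constraint last res by blast
qed

text \<open>\<open>K\<close> is chosen so that the averaged bound
  \<open>K * \<theta> \<le> B\<close> becomes
  \<open>\<kappa> * \<theta> \<le> \<epsilon>\<^sup>2\<close>, where \<kappa> is the largest of the
  three constants.\<close>

lemma (in algorithm4_run) eps_stationary_arg_min:
  fixes K :: int
  assumes "0 < \<epsilon>" and \<tau>: "0 < \<tau>" and \<sigma>: "2 * \<alpha> / s < \<sigma>"
    and C: "\<And>k i. 3 \<le> k \<Longrightarrow> norm (GAL (lam k) (z k i)) \<le> C"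
    and \<kappa>3: "\<kappa>3 = ((L + sqrt N * \<beta> * A_max\<^sup>2) * max L1 1 + W C + \<beta> * A_max * sqrt \<kappa>1)\<^sup>2"
    and K: "K = \<lceil>3 * max \<kappa>1 (max ((\<bar>\<beta> - 1 / \<gamma>\<bar> + L)\<^sup>2) \<kappa>3) / (\<tau> * \<epsilon>\<^sup>2) * (\<Psi> 0 - fstar)\<rceil>"
    and arg_min: "is_arg_min (\<lambda>k. S (k + 1) + S k + S (k - 1)) (\<lambda>k. 2 \<le> k \<and> int k \<le> K + 1) k"
  shows "eps_stationary blk N A b f M \<epsilon> (x (k + 1)) (lam (k + 1))"
proof -
  define \<kappa> where "\<kappa> = max \<kappa>1 (max ((\<bar>\<beta> - 1 / \<gamma>\<bar> + L)\<^sup>2) \<kappa>3)"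
  define B where "B = 3 * ((\<Psi> 0 - fstar) / \<tau>)"
  have \<kappa>0: "0 \<le> \<kappa>" using \<kappa>1_nonneg by (simp add: \<kappa>_def le_max_iff_disj)
  have "2 \<le> k" using arg_min by (simp add: is_arg_min_def)
  \<comment> \<open>The shift makes \<open>j\<close> the first index of the window, and
    \<open>Suc (Suc j)\<close> is at least 3, where the gradient bound holds.\<close>
  then obtain j where j: "k = Suc j" "1 \<le> j" by (cases k) auto
  define \<theta> where "\<theta> = S (Suc (Suc j)) + S (Suc j) + S j"
  have \<theta>: "K * \<theta> \<le> B" and K1: "1 \<le> K"
    using arg_min_S_le[OF \<tau> arg_min] by (simp_all add: \<theta>_def B_def j)
  have "\<kappa> * B / \<epsilon>\<^sup>2 \<le> K"
    unfolding K \<kappa>_def[symmetric] B_def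
    by (rule order_trans[OF _ le_of_int_ceiling]) (simp add: field_simps)
  then have "\<kappa> * B \<le> K * \<epsilon>\<^sup>2"
    using assms(1) by (simp add: pos_divide_le_eq)
  moreover have "\<kappa> * (K * \<theta>) \<le> \<kappa> * B" using \<theta> \<kappa>0 by (rule mult_left_mono)
  ultimately have "K * (\<kappa> * \<theta>) \<le> K * \<epsilon>\<^sup>2" by (simp add: mult_ac)
  then have "\<kappa> * \<theta> \<le> \<epsilon>\<^sup>2" using K1 by (simp add: mult_le_cancel_left)
  then have "eps_stationary blk N A b f M \<epsilon> (x (Suc (Suc j))) (lam (Suc (Suc j)))"
    using C j(2) unfolding \<kappa>_def by (intro eps_stationary_if_le[OF assms(1) \<theta>_def \<sigma> _ \<kappa>3]) auto
  then show ?thesis by (simp add: j)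
qed

text \<open>The admissible interval for \<open>\<gamma>\<close> says that \<open>1 / \<gamma>\<close> lies strictly between the roots of
  \<open>12 u\<^sup>2 - 26 \<beta> u + 13 \<beta>\<^sup>2 + \<beta> L + 6 L\<^sup>2\<close>, which is \<open>2 \<beta>\<close> times the first coefficient
  of \<open>\<tau>\<close>; the bound on \<open>\<beta>\<close> makes the roots real.\<close>

lemma last_block_coefficient_neg:
  fixes \<beta> \<gamma> L :: real
  assumes "0 < \<beta>" "0 < \<gamma>" "0 < L" and \<beta>: "\<beta> > (6 + 18 * sqrt 3) / 13 * L"
    and \<gamma>: "\<gamma> \<in> {12 / (13 * \<beta> + sqrt (13 * \<beta>\<^sup>2 - 12 * \<beta> * L - 72 * L\<^sup>2))
                <..< 12 / (13 * \<beta> - sqrt (13 * \<beta>\<^sup>2 - 12 * \<beta> * L - 72 * L\<^sup>2))}"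
  shows "(\<beta> + L) / 2 - 1 / \<gamma> + 6 / \<beta> * (\<beta> - 1 / \<gamma>)\<^sup>2 + 3 * L\<^sup>2 / \<beta> < 0"
proof -
  define q where "q = 13 * \<beta>\<^sup>2 - 12 * \<beta> * L - 72 * L\<^sup>2"
  define u where "u = 1 / \<gamma>"
  have "18 * sqrt 3 * L < 13 * \<beta> - 6 * L" using \<beta> by (simp add: field_simps)
  then have "(18 * sqrt 3 * L)\<^sup>2 < (13 * \<beta> - 6 * L)\<^sup>2"
    using assms(3) by (intro power_strict_mono) auto
  \<comment> \<open>Completing the square in \<beta>; 972 is the square of
    \<open>18 * sqrt 3\<close>, which explains the constant in the bound on \<beta>.\<close>
  also have "\<dots> = 13 * q + 972 * L\<^sup>2"
    by (simp add: q_def power2_eq_square algebra_simps)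
  also have "(18 * sqrt 3 * L)\<^sup>2 = 972 * L\<^sup>2" by (simp add: power_mult_distrib)
  finally have q: "0 < q" by simp
  \<comment> \<open>Makes the denominator \<open>13 * \<beta> - sqrt q\<close> positive, so that the
    right endpoint for \<gamma> can be cleared of it.\<close>
  have "q < (13 * \<beta>)\<^sup>2"
    using assms(1,3) by (simp add: q_def power_mult_distrib) (smt (verit) mult_pos_pos zero_less_power)
  then have w: "sqrt q < 13 * \<beta>" using assms(1) by (simp add: real_less_lsqrt)
  have "12 < \<gamma> * (13 * \<beta> + sqrt q)" "\<gamma> * (13 * \<beta> - sqrt q) < 12"
    using \<gamma> w q assms(1) unfolding q_def[symmetric]
    by (auto simp: pos_divide_less_eq pos_less_divide_eq add_pos_nonneg)
  then have "12 * u < 13 * \<beta> + sqrt q" "13 * \<beta> - sqrt q < 12 * u"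
    using assms(2) by (simp_all add: u_def field_simps)
  then have "\<bar>12 * u - 13 * \<beta>\<bar> < sqrt q" by linarith
  then have "(12 * u - 13 * \<beta>)\<^sup>2 < q"
    using q by (metis abs_ge_zero power2_abs power_strict_mono real_sqrt_pow2 less_imp_le zero_less_numeral)
  then have "12 * u\<^sup>2 - 26 * \<beta> * u + 13 * \<beta>\<^sup>2 + \<beta> * L + 6 * L\<^sup>2 < 0"
    by (simp add: q_def power2_eq_square algebra_simps)
  moreover have "(\<beta> + L) / 2 - u + 6 / \<beta> * (\<beta> - u)\<^sup>2 + 3 * L\<^sup>2 / \<beta>
      = (12 * u\<^sup>2 - 26 * \<beta> * u + 13 * \<beta>\<^sup>2 + \<beta> * L + 6 * L\<^sup>2) / (2 * \<beta>)"
    using assms(1) by (simp add: field_simps power2_eq_square)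
  ultimately show ?thesis
    using assms(1) by (simp add: u_def divide_neg_pos)
qed

theorem theorem3p18:
  fixes blk :: "'n::finite \<Rightarrow> nat" and N :: nat
    and A :: "real ^ 'n ^ 'm" and b :: "real ^ 'm" and last_col :: "'m::finite \<Rightarrow> 'n"
    and f :: "real ^ 'n \<Rightarrow> real" and fstar L L1 L2 :: real
    and M :: "nat \<Rightarrow> (real ^ 'n) set" and R :: "nat \<Rightarrow> real ^ 'n \<Rightarrow> real ^ 'n \<Rightarrow> real ^ 'n"
    and \<beta> \<gamma> \<sigma> s \<alpha> Amax \<tau> \<kappa>1 \<kappa>2 :: real
  assumes blocks: "range blk = {1..N}"
    and A_N_square: "bij_betw last_col UNIV {c. blk c = N}"
    and A_N_identity: "\<And>p q. A $ p $ last_col q = (if p = q then 1 else 0)"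
    and L_pos: "0 < L"
    and f_diff: "\<And>x. f differentiable (at x)"
    and f_grad_lipschitz: "L-lipschitz_on UNIV (gradient f)"
    and M_ambient: "\<And>i. i \<in> {1..<N} \<Longrightarrow> M i \<subseteq> block_space blk i"
    and M_compact: "\<And>i. i \<in> {1..<N} \<Longrightarrow> compact (M i)"
    and M_submanifold: "\<And>i. i \<in> {1..<N} \<Longrightarrow> \<exists>d. embedded_submanifold d (M i)"
    and f_bounded: "bdd_below (f ` manifold_constraint blk N M)"
    and fstar: "fstar = (INF x\<in>manifold_constraint blk N M. f x)"
    and R_retraction: "\<And>i. i \<in> {1..<N} \<Longrightarrow> manifold_retraction (M i) (R i)"
    and L1_pos: "0 < L1" and L2_pos: "0 < L2"
    and R_L1: "\<And>i y v u. i \<in> {1..<N} \<Longrightarrow> y \<in> M i \<Longrightarrow> v \<in> tangent_space (M i) y \<Longrightarrow> 0 \<le> u \<Longrightarrow>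
                 norm (R i y (u *\<^sub>R v) - y) \<le> L1 * u * norm v"
    and R_L2: "\<And>i y v u. i \<in> {1..<N} \<Longrightarrow> y \<in> M i \<Longrightarrow> v \<in> tangent_space (M i) y \<Longrightarrow> 0 \<le> u \<Longrightarrow>
                 norm (R i y (u *\<^sub>R v) - y - u *\<^sub>R v) \<le> L2 * u\<^sup>2 * (norm v)\<^sup>2"
    and params_pos: "0 < \<beta>" "0 < \<gamma>" "0 < \<sigma>" "0 < s" and \<alpha>: "0 < \<alpha>" "\<alpha> < 1"
    and \<beta>: "\<beta> > (6 + 18 * sqrt 3) / 13 * L"
    and \<gamma>: "\<gamma> \<in> {12 / (13 * \<beta> + sqrt (13 * \<beta>\<^sup>2 - 12 * \<beta> * L - 72 * L\<^sup>2))
                <..< 12 / (13 * \<beta> - sqrt (13 * \<beta>\<^sup>2 - 12 * \<beta> * L - 72 * L\<^sup>2))}"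
    and \<sigma>: "\<sigma> > max (6 / \<beta> * L\<^sup>2 * L1\<^sup>2) (2 * \<alpha> / s)"
    and Amax: "Amax = Max ((\<lambda>j. onorm (\<lambda>y. col_block blk A j *v y)) ` {1..N})"
    and \<tau>: "\<tau> = min (- ((\<beta> + L) / 2 - 1 / \<gamma> + 6 / \<beta> * (\<beta> - 1 / \<gamma>)\<^sup>2 + 3 * L\<^sup>2 / \<beta>))
                    (\<sigma> / 2 - 3 / \<beta> * L\<^sup>2 * L1\<^sup>2)"
    and \<kappa>1: "\<kappa>1 = 3 / \<beta>\<^sup>2 * ((\<beta> - 1 / \<gamma>)\<^sup>2 + L\<^sup>2 * max (L1\<^sup>2) 1)"
    and \<kappa>2: "\<kappa>2 = (\<bar>\<beta> - 1 / \<gamma>\<bar> + L)\<^sup>2"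
  shows "\<exists>C :: real ^ 'n \<Rightarrow> real ^ 'm \<Rightarrow> real ^ 'n \<Rightarrow> real ^ 'm \<Rightarrow> real.
    \<forall>x lam t g. algorithm4 blk N A b f M R \<beta> \<gamma> \<sigma> s \<alpha> x lam t g \<longrightarrow>
      (let C0 = C (x 0) (lam 0) (x 1) (lam 1);
           \<kappa>3 = ((L + sqrt N * \<beta> * Amax\<^sup>2) * max L1 1
                  + (\<sigma> + 2 * L2 * C0 + (L + \<beta> * Amax\<^sup>2) * L1\<^sup>2) / (2 * \<alpha>)
                  + \<beta> * Amax * sqrt \<kappa>1)\<^sup>2;
           S = (\<lambda>k. \<Sum>i=1..N. (norm (t k i *\<^sub>R g k i))\<^sup>2)
       in C0 > 0 \<and>
          (\<forall>\<epsilon>>0.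
             let K = \<lceil>3 * max \<kappa>1 (max \<kappa>2 \<kappa>3) / (\<tau> * \<epsilon>\<^sup>2) *
                        (potential_G blk N A b f L \<beta> \<gamma> (x 1) (lam 1) (block blk N (x 0)) - fstar)\<rceil>
             in \<forall>kstar. is_arg_min (\<lambda>k. S (k + 1) + S k + S (k - 1))
                                    (\<lambda>k. 2 \<le> k \<and> int k \<le> K + 1) kstar \<longrightarrow>
                  eps_stationary blk N A b f M \<epsilon> (x (kstar + 1)) (lam (kstar + 1))))"
proof -
  interpret block_data blk N A b last_col f L \<beta>
    by unfold_locales (fact blocks A_N_square A_N_identity f_diff f_grad_lipschitz L_pos params_pos)+
  have \<tau>_pos: "0 < \<tau>"
  proof -
    have "6 / \<beta> * L\<^sup>2 * L1\<^sup>2 < \<sigma>" using \<sigma> by simp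
    then have "0 < \<sigma> / 2 - 3 / \<beta> * L\<^sup>2 * L1\<^sup>2" by simp
    then show ?thesis
      using last_block_coefficient_neg[OF params_pos(1,2) L_pos \<beta> \<gamma>] unfolding \<tau> by simp
  qed
  have \<sigma>': "2 * \<alpha> / s < \<sigma>" using \<sigma> by simp
  obtain m where m: "\<And>y. y \<in> manifold_constraint blk N M \<Longrightarrow> norm (y - block blk N y) \<le> m"
    using norm_manifold_part_bounded[of M] M_compact compact_imp_bounded by metis
  define \<Psi>1 where "\<Psi>1 x0 x1 l1 = potential_G blk N A b f L \<beta> \<gamma> x1 l1 (block blk N x0)" for x0 x1 l1
  \<comment> \<open>The witness is fixed before the run. Run-dependent values enter only through the
    potential at the first iterate and the norm of that iterate.\<close>
  define C where "C x0 l0 x1 l1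
    = gradient_bound \<gamma> m \<kappa>1 ((\<Psi>1 x0 x1 l1 - fstar) / \<tau>) (norm x1)" for x0 x1 :: "real ^ 'n" and l0 l1 :: "real ^ 'm"
  show ?thesis
  proof (intro exI[of _ C] allI impI)
    fix x lam t g
    assume alg: "algorithm4 blk N A b f M R \<beta> \<gamma> \<sigma> s \<alpha> x lam t g"
    interpret run: algorithm4_run blk N A b last_col f L \<beta> M R fstar L1 L2 \<gamma> \<sigma> s \<alpha> x lam t g
    proof
      show "fstar \<le> f y" if "y \<in> manifold_constraint blk N M" for y
        unfolding fstar using f_bounded that by (rule cINF_lower)
    qed (fact M_ambient M_submanifold R_retraction L1_pos L2_pos R_L1 R_L2 params_pos \<alpha> alg)+
    have eqs: "run.\<tau> = \<tau>" "run.\<kappa>1 = \<kappa>1" "A_max = Amax"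
      by (simp_all add: run.\<tau>_def \<tau> run.\<kappa>1_def \<kappa>1 A_max_def Amax)
    let ?C = "C (x 0) (lam 0) (x 1) (lam 1)"
    have C: "norm (GAL (lam k) (run.z k i)) < ?C" if "3 \<le> k" for k i
      using run.norm_GAL_le[OF _ refl m that, of i] \<tau>_pos unfolding eqs C_def \<Psi>1_def by simp
    \<comment> \<open>Positivity comes from the strict inequality in \<open>norm_GAL_le\<close>, due
      to the summand 1 in \<open>gradient_bound\<close>.\<close>
    have "0 < ?C" using C[of 3 0] by (smt (verit) norm_ge_zero order_refl)
    then show "let C0 = C (x 0) (lam 0) (x 1) (lam 1);
           \<kappa>3 = ((L + sqrt N * \<beta> * Amax\<^sup>2) * max L1 1
                  + (\<sigma> + 2 * L2 * C0 + (L + \<beta> * Amax\<^sup>2) * L1\<^sup>2) / (2 * \<alpha>)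
                  + \<beta> * Amax * sqrt \<kappa>1)\<^sup>2;
           S = (\<lambda>k. \<Sum>i=1..N. (norm (t k i *\<^sub>R g k i))\<^sup>2)
       in C0 > 0 \<and>
          (\<forall>\<epsilon>>0.
             let K = \<lceil>3 * max \<kappa>1 (max \<kappa>2 \<kappa>3) / (\<tau> * \<epsilon>\<^sup>2) *
                        (potential_G blk N A b f L \<beta> \<gamma> (x 1) (lam 1) (block blk N (x 0)) - fstar)\<rceil>
             in \<forall>kstar. is_arg_min (\<lambda>k. S (k + 1) + S k + S (k - 1))
                                    (\<lambda>k. 2 \<le> k \<and> int k \<le> K + 1) kstar \<longrightarrow>
                  eps_stationary blk N A b f M \<epsilon> (x (kstar + 1)) (lam (kstar + 1)))"
      unfolding Let_def
    proof (intro conjI allI impI, goal_cases)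
      case (2 \<epsilon> k)
      show ?case
        by (rule run.eps_stationary_arg_min[OF 2(2) _ \<sigma>' less_imp_le[OF C] refl refl])
          (use 2(3) \<tau>_pos in \<open>simp_all add: eqs \<kappa>2 run.W_def run.S_def run.T_def\<close>)
    qed
  qed
qed

end
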